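(* For any domain $U\subset V$, $\widehat Y^U$ has the strong Feller property in the resolvent sense; that is, for every bounded Borel function $f$ on $U$ and every $\lambda\ge0$, $\widehat G^U_\lambda f(x)$ is a bounded continuous function on $U$.
   Context: Setting. Let $d\ge3$. For a signed Radon measure $\eta$ on $\mathbf R^d$ and $j=1,2$ put $M^j_\eta(r)=\sup_{x}\int_{|x-y|\le r}|x-y|^{j-d}|\eta|(dy)$; $\eta\in\mathbf K_{d,j}$ means $\lim_{r\downarrow0}M^j_\eta(r)=0$. Fix $\mu=(\mu^1,\dots,\mu^d)$ with each $\mu^i$ a signed measure in $\mathbf K_{d,1}$, and a nonnegative measure $\nu\in\mathbf K_{d,2}$. Let $\mathbf A(x)=(a_{ij}(x))$ be symmetric, $C^1$ and uniformly elliptic on $\mathbf R^d$, and let $L$ be either $\frac12\sum_{i,j}\partial_i(a_{ij}\partial_j)$ or $\frac12\sum_{i,j}a_{ij}\partial_i\partial_j$. $X$ is the diffusion on $\mathbf R^d$ with generator formally $L+\mu\cdot\nabla$, i.e. the unique-in-law process such that under $\mathbf P_x$, $X_t=x+\int_0^t\sigma(X_s)dW_s+\int_0^tb(X_s)ds+N_t$, where $W$ is a Brownian motion, $\sigma=\mathbf A^{1/2}$, $b_j=\frac12\sum_i\partial_ia_{ij}$ in the first case and $b=0$ in the second, and $N^j_t=\lim_n\int_0^t(\varphi_n*\mu^j)(X_s)ds$ in probability, uniformly on finite time intervals, with $\sup_k\int_0^t|\varphi_{n_k}*\mu^j|(X_s)ds<\infty$ a.s. for all $t$ along some subsequence; here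 $\varphi_n(x)=2^{nd}\varphi(2^nx)$ with $\varphi\ge0$ smooth, radial, supported in $B(0,1)$, $\int\varphi=1$. $V$ is a fixed bounded smooth domain; $X^V$ is $X$ killed on exiting $V$, with jointly continuous transition density $q^V$ (Lebesgue measure); $A^V$ is the positive continuous additive functional of $X^V$ with $\mathbf E_x\int_0^tf(X^V_s)dA^V_s=\int_0^t\int_Vq^V(s,x,y)f(y)\nu(dy)ds$ for bounded $f\ge0$. $Y$ is the process on $V$ with $\mathbf E_x[f(Y_t)]=\mathbf E_x[\exp(-A^V_t)f(X^V_t)]$ (killing of $X^V$ by $\exp(-A^V)$); functions are $0$ at the cemetery. For open $U\subset V$: $\tau_U=\inf\{t>0:Y_t\notin U\}$, $Y^U$ is $Y$ killed at $\tau_U$, $r^U(t,x,y)$ is its jointly continuous transition density with respect to Lebesgue measure ($r=r^V$), $G_U(x,y)=\int_0^\infty r^U(t,x,y)dt$, $G=G_V$. $H(x)=\int_VG(y,x)dy$ (strictly positive, bounded, continuous), $\xi(dx)=H(x)dx$. Dual. $\widehat Y$ is the dual of $Y$ with respect to $\xi$: the continuous transient Hunt process on $V$ with transition density $r(t,y,x)H(y)/H(x)$ in $(t,x,y)$ with respect to Lebesgue measure $dy$. For a domain $U\subset V$, $\widehat Y^U$ is $\widehat Y$ killed on exiting $U$; it has transition density $\widehat r^U(t,x,y)=r^U(t,y,x)H(y)/H(x)$ with respect to Lebesgue measure, and $\widehat G^U_\lambda f(x)=\mathbf E_x\int_0^\infty e^{-\lambda t}f(\widehat Y^U_t)dt$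 is its resolvent; in particular $\widehat G^U_0f(x)=\int_U\frac{G_U(y,x)H(y)}{H(x)}f(y)dy$. *)

theory Defs
  imports "HOL-Probability.Probability" "HOL-Probability.Stopping_Time"
begin

section \<open>Regularity and domains\<close>

text \<open>On an open set \<open>S\<close>: all iterated directional derivatives up to order \<open>k\<close> exist and are
  continuous.\<close>

primrec Ck_on :: "nat \<Rightarrow> ('a::euclidean_space \<Rightarrow> 'b::real_normed_vector) \<Rightarrow> 'a set \<Rightarrow> bool" where
  "Ck_on 0 f S \<longleftrightarrow> continuous_on S f"
| "Ck_on (Suc k) f S \<longleftrightarrow>
     (\<forall>x\<in>S. f differentiable (at x)) \<and> (\<forall>v. Ck_on k (\<lambda>x. frechet_derivative f (at x) v) S)"

definition smooth_on :: "('a::euclidean_space \<Rightarrow> 'b::real_normed_vector) \<Rightarrow> 'a set \<Rightarrow> bool" where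
  "smooth_on f S \<longleftrightarrow> (\<forall>k. Ck_on k f S)"

definition is_domain :: "'a::euclidean_space set \<Rightarrow> bool" where
  "is_domain D \<longleftrightarrow> open D \<and> connected D \<and> D \<noteq> {}"

text \<open>A domain with \<open>C\<^sup>\<infinity>\<close> boundary, described by local defining functions.\<close>

definition smooth_domain :: "'a::euclidean_space set \<Rightarrow> bool" where
  "smooth_domain D \<longleftrightarrow> is_domain D \<and>
     (\<forall>z\<in>frontier D. \<exists>N \<rho>. open N \<and> z \<in> N \<and> smooth_on (\<rho> :: 'a \<Rightarrow> real) N \<and>
        (\<exists>v. frechet_derivative \<rho> (at z) v \<noteq> 0) \<and> D \<inter> N = {x\<in>N. \<rho> x < 0})"


section \<open>Signed Radon measures and Kato classes\<close>

text \<open>A signed Radon measure is represented by its Jordan decomposition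
  (positive part, negative part).\<close>

type_synonym 'a signed_measure = "'a measure \<times> 'a measure"

definition radon :: "'a::euclidean_space measure \<Rightarrow> bool" where
  "radon m \<longleftrightarrow> sets m = sets borel \<and> (\<forall>K. compact K \<longrightarrow> emeasure m K < \<infinity>)"

definition signed_radon :: "'a::euclidean_space signed_measure \<Rightarrow> bool" where
  "signed_radon \<eta> \<longleftrightarrow> radon (fst \<eta>) \<and> radon (snd \<eta>) \<and>
     (\<exists>S\<in>sets borel. emeasure (fst \<eta>) S = 0 \<and> emeasure (snd \<eta>) (- S) = 0)"

text \<open>The kernel \<open>|x - y|\<^bsup>j-d\<^esup>\<close> takes values in \<open>ennreal\<close>, so that it is \<open>\<infinity>\<close> (and
  not \<open>0\<close>) on the diagonal; atoms are thereby excluded from the Kato classes. The integral against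
  the total variation is the sum of the integrals against the two parts.\<close>

definition kato_M :: "nat \<Rightarrow> (real^'d::finite) signed_measure \<Rightarrow> real \<Rightarrow> ennreal" where
  "kato_M j \<eta> r = (SUP x.
     (\<integral>\<^sup>+y\<in>cball x r. inverse (ennreal (dist x y) ^ (CARD('d) - j)) \<partial>fst \<eta>) +
     (\<integral>\<^sup>+y\<in>cball x r. inverse (ennreal (dist x y) ^ (CARD('d) - j)) \<partial>snd \<eta>))"

definition kato_class :: "nat \<Rightarrow> (real^'d::finite) signed_measure \<Rightarrow> bool" where
  "kato_class j \<eta> \<longleftrightarrow> signed_radon \<eta> \<and> (kato_M j \<eta> \<longlongrightarrow> 0) (at_right 0)"

definition nonneg_signed :: "'a::euclidean_space measure \<Rightarrow> 'a signed_measure" where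
  "nonneg_signed m = (m, null_measure borel)"


section \<open>Mollification\<close>

definition mollifier :: "(real^'d::finite \<Rightarrow> real) \<Rightarrow> bool" where
  "mollifier \<phi> \<longleftrightarrow> smooth_on \<phi> UNIV \<and> (\<forall>x. 0 \<le> \<phi> x) \<and>
     (\<forall>x y. norm x = norm y \<longrightarrow> \<phi> x = \<phi> y) \<and> {x. \<phi> x \<noteq> 0} \<subseteq> ball 0 1 \<and>
     (\<integral>x. \<phi> x \<partial>lborel) = 1"

definition mollifier_scaled :: "(real^'d::finite \<Rightarrow> real) \<Rightarrow> nat \<Rightarrow> real^'d \<Rightarrow> real" where
  "mollifier_scaled \<phi> n x = 2 ^ (n * CARD('d)) * \<phi> (2 ^ n *\<^sub>R x)"

definition mollify :: "(real^'d::finite \<Rightarrow> real) \<Rightarrow> nat \<Rightarrow> (real^'d) signed_measure \<Rightarrow> real^'d \<Rightarrow> real" where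
  "mollify \<phi> n \<eta> x = (\<integral>y. mollifier_scaled \<phi> n (x - y) \<partial>fst \<eta>)
                    - (\<integral>y. mollifier_scaled \<phi> n (x - y) \<partial>snd \<eta>)"


section \<open>Coefficients of the operator L\<close>

definition symmetric_coefficients :: "(real^'d::finite \<Rightarrow> real^'d^'d) \<Rightarrow> bool" where
  "symmetric_coefficients A \<longleftrightarrow> (\<forall>x. transpose (A x) = A x)"

definition uniformly_elliptic :: "(real^'d::finite \<Rightarrow> real^'d^'d) \<Rightarrow> bool" where
  "uniformly_elliptic A \<longleftrightarrow> (\<exists>c>0. \<exists>C. \<forall>x v.
     c * (norm v)\<^sup>2 \<le> v \<bullet> (A x *v v) \<and> v \<bullet> (A x *v v) \<le> C * (norm v)\<^sup>2)"

definition matrix_sqrt :: "real^'d::finite^'d \<Rightarrow> real^'d^'d" where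
  "matrix_sqrt M = (THE S. transpose S = S \<and> (\<forall>v. 0 \<le> v \<bullet> (S *v v)) \<and> S ** S = M)"

text \<open>\<open>L\<close> is \<open>1/2 \<Sum> \<partial>\<^sub>i (a\<^sub>i\<^sub>j \<partial>\<^sub>j)\<close> or \<open>1/2 \<Sum> a\<^sub>i\<^sub>j \<partial>\<^sub>i \<partial>\<^sub>j\<close>. The two have the same second-order part,
  and the first-order part is \<open>first_order_drift\<close>.\<close>

datatype operator_form = Divergence_Form | Nondivergence_Form

definition first_order_drift ::
  "operator_form \<Rightarrow> (real^'d::finite \<Rightarrow> real^'d^'d) \<Rightarrow> real^'d \<Rightarrow> real^'d" where
  "first_order_drift L A x = (case L of
      Divergence_Form \<Rightarrow>
        (\<chi> j. (1/2) * (\<Sum>i\<in>UNIV. frechet_derivative (\<lambda>z. A z $ i $ j) (at x) (axis i 1)))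
    | Nondivergence_Form \<Rightarrow> 0)"


section \<open>Hunt processes\<close>

text \<open>State spaces are subsets \<open>E\<close> of a Euclidean space. \<open>None\<close> is the cemetery, adjoined to \<open>E\<close> as
  the point at infinity of the one-point compactification. \<open>\<Omega>\<close> only provides the
  sample space and its \<open>\<sigma>\<close>-algebra, shared by all laws \<open>law p z\<close>; \<open>shift\<close> is the family of
  translation operators.\<close>

record ('w, 'a) process =
  sample :: "'w measure"
  law :: "'a option \<Rightarrow> 'w measure"
  path :: "real \<Rightarrow> 'w \<Rightarrow> 'a option"
  shift :: "real \<Rightarrow> 'w \<Rightarrow> 'w"

text \<open>Functions vanish at the cemetery.\<close>

definition ext0 :: "('a \<Rightarrow> 'b::zero) \<Rightarrow> 'a option \<Rightarrow> 'b" where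
  "ext0 f z = (case z of None \<Rightarrow> 0 | Some y \<Rightarrow> f y)"

definition exit_time :: "'a set \<Rightarrow> (real \<Rightarrow> 'w \<Rightarrow> 'a option) \<Rightarrow> 'w \<Rightarrow> ereal" where
  "exit_time U Z \<omega> = Inf (ereal ` {t. t > 0 \<and> Z t \<omega> \<notin> Some ` U})"

definition lifetime :: "(real \<Rightarrow> 'w \<Rightarrow> 'a option) \<Rightarrow> 'w \<Rightarrow> ereal" where
  "lifetime Z \<omega> = Inf (ereal ` {t. t \<ge> 0 \<and> Z t \<omega> = None})"

definition killed :: "'a set \<Rightarrow> (real \<Rightarrow> 'w \<Rightarrow> 'a option) \<Rightarrow> real \<Rightarrow> 'w \<Rightarrow> 'a option" where
  "killed U Z t \<omega> = (if ereal t < exit_time U Z \<omega> then Z t \<omega> else None)"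

definition natural_filtration ::
  "'w set \<Rightarrow> (real \<Rightarrow> 'w \<Rightarrow> 'a::euclidean_space option) \<Rightarrow> real \<Rightarrow> 'w measure" where
  "natural_filtration \<Omega> Z t =
     sigma \<Omega> {{\<omega>\<in>\<Omega>. Z s \<omega> \<in> Some ` B} | s B. 0 \<le> s \<and> s \<le> t \<and> B \<in> sets borel}"

text \<open>Optional times, i.e. stopping times of the right-continuous filtration \<open>\<F>\<^sub>t\<^sub>+\<close>, with the
  value \<open>\<infinity>\<close> allowed, and the \<open>\<sigma>\<close>-algebra \<open>\<F>\<^sub>T\<^sub>+\<close>.\<close>

definition optional_time :: "('w, 'a::euclidean_space) process \<Rightarrow> ('w \<Rightarrow> ennreal) \<Rightarrow> bool" where
  "optional_time p T \<longleftrightarrow> (\<forall>t\<ge>0. {\<omega>\<in>space (sample p). T \<omega> < ennreal t}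
     \<in> sets (natural_filtration (space (sample p)) (path p) t))"

definition events_upto ::
  "('w, 'a::euclidean_space) process \<Rightarrow> ('w \<Rightarrow> ennreal) \<Rightarrow> 'w set set" where
  "events_upto p T = {\<Lambda>\<in>sets (sample p). \<forall>t\<ge>0. {\<omega>\<in>\<Lambda>. T \<omega> < ennreal t}
     \<in> sets (natural_filtration (space (sample p)) (path p) t)}"

definition strong_markov :: "'a::euclidean_space set \<Rightarrow> ('w, 'a) process \<Rightarrow> bool" where
  "strong_markov E p \<longleftrightarrow>
     (\<forall>z \<in> insert None (Some ` E). \<forall>T \<Lambda>. optional_time p T \<longrightarrow> \<Lambda> \<in> events_upto p T \<longrightarrow>
       (\<forall>t\<ge>0. \<forall>B\<in>sets borel.
          emeasure (law p z) {\<omega>\<in>\<Lambda>. T \<omega> < \<infinity> \<and> path p (enn2real (T \<omega>) + t) \<omega> \<in> Some ` B} =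
          (\<integral>\<^sup>+\<omega>\<in>{\<omega>\<in>\<Lambda>. T \<omega> < \<infinity>}.
             emeasure (law p (path p (enn2real (T \<omega>)) \<omega>))
               {\<omega>'\<in>space (sample p). path p t \<omega>' \<in> Some ` B} \<partial>law p z)))"

definition quasi_left_continuous :: "'a::euclidean_space set \<Rightarrow> ('w, 'a) process \<Rightarrow> bool" where
  "quasi_left_continuous E p \<longleftrightarrow>
     (\<forall>z \<in> insert None (Some ` E). \<forall>T :: nat \<Rightarrow> 'w \<Rightarrow> ennreal.
        (\<forall>n. optional_time p (T n)) \<longrightarrow> (\<forall>\<omega>. incseq (\<lambda>n. T n \<omega>)) \<longrightarrow>
        (AE \<omega> in law p z. (SUP n. T n \<omega>) < \<infinity> \<longrightarrow>
           limitin (Alexandroff_compactification (top_of_set E))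
             (\<lambda>n. path p (enn2real (T n \<omega>)) \<omega>)
             (path p (enn2real (SUP n. T n \<omega>)) \<omega>) sequentially))"

definition hunt_process :: "'a::euclidean_space set \<Rightarrow> ('w, 'a) process \<Rightarrow> bool" where
  "hunt_process E p \<longleftrightarrow>
     (\<forall>z. prob_space (law p z) \<and> space (law p z) = space (sample p) \<and>
          sets (law p z) = sets (sample p)) \<and>
     (\<forall>t\<ge>0. \<forall>\<omega>\<in>space (sample p). path p t \<omega> \<in> insert None (Some ` E)) \<and>
     (\<forall>t\<ge>0. \<forall>B\<in>sets borel. {\<omega>\<in>space (sample p). path p t \<omega> \<in> Some ` B} \<in> sets (sample p)) \<and>
     (\<forall>z \<in> insert None (Some ` E). AE \<omega> in law p z. path p 0 \<omega> = z) \<and>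
     (\<forall>t\<ge>0. \<forall>B\<in>sets borel.
        (\<lambda>x. emeasure (law p (Some x)) {\<omega>\<in>space (sample p). path p t \<omega> \<in> Some ` B})
          \<in> borel_measurable (restrict_space borel E)) \<and>
     (\<forall>t\<ge>0. \<forall>\<omega>\<in>space (sample p). shift p t \<omega> \<in> space (sample p) \<and>
        (\<forall>s\<ge>0. path p s (shift p t \<omega>) = path p (t + s) \<omega>)) \<and>
     (\<forall>\<omega>\<in>space (sample p). \<forall>s\<ge>0. \<forall>t\<ge>s. path p s \<omega> = None \<longrightarrow> path p t \<omega> = None) \<and>
     (\<forall>\<omega>\<in>space (sample p). \<forall>t\<ge>0.
        limitin (Alexandroff_compactification (top_of_set E))
          (\<lambda>s. path p s \<omega>) (path p t \<omega>) (at_right t)) \<and>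
     (\<forall>\<omega>\<in>space (sample p). \<forall>t>0. \<exists>l.
        limitin (Alexandroff_compactification (top_of_set E)) (\<lambda>s. path p s \<omega>) l (at_left t)) \<and>
     strong_markov E p \<and> quasi_left_continuous E p"

text \<open>Continuity is continuity on \<open>[0, lifetime)\<close>: the process may be killed inside \<open>E\<close>.\<close>

definition continuous_process :: "('w, 'a::euclidean_space) process \<Rightarrow> bool" where
  "continuous_process p \<longleftrightarrow> (\<forall>\<omega>\<in>space (sample p).
     continuous_on {t. 0 \<le> t \<and> ereal t < lifetime (path p) \<omega>} (\<lambda>t. the (path p t \<omega>)))"

definition transient_process :: "'a::euclidean_space set \<Rightarrow> ('w, 'a) process \<Rightarrow> bool" where
  "transient_process E p \<longleftrightarrow>
     (\<exists>g :: 'a \<Rightarrow> real. g \<in> borel_measurable (restrict_space borel E) \<and> (\<forall>x\<in>E. 0 < g x) \<and>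
       (\<forall>x\<in>E. (\<integral>\<^sup>+\<omega>. (\<integral>\<^sup>+t\<in>{0..}. ennreal (ext0 g (path p t \<omega>)) \<partial>lborel) \<partial>law p (Some x)) < \<infinity>))"

text \<open>Transition densities with respect to Lebesgue measure, for a process \<open>Z\<close> in
  \<open>U \<union> {None}\<close> under the laws \<open>P\<close>.\<close>

definition has_transition_density ::
  "'a::euclidean_space set \<Rightarrow> ('a option \<Rightarrow> 'w measure) \<Rightarrow> (real \<Rightarrow> 'w \<Rightarrow> 'a option) \<Rightarrow>
   (real \<Rightarrow> 'a \<Rightarrow> 'a \<Rightarrow> real) \<Rightarrow> bool" where
  "has_transition_density U P Z q \<longleftrightarrow> (\<forall>t>0. \<forall>x\<in>U.
     (\<forall>y\<in>U. 0 \<le> q t x y) \<and> q t x \<in> borel_measurable (restrict_space borel U) \<and>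
     (\<forall>B\<in>sets borel. B \<subseteq> U \<longrightarrow>
        emeasure (P (Some x)) {\<omega>\<in>space (P (Some x)). Z t \<omega> \<in> Some ` B} =
        (\<integral>\<^sup>+y\<in>B. ennreal (q t x y) \<partial>lborel)))"

definition has_continuous_transition_density ::
  "'a::euclidean_space set \<Rightarrow> ('a option \<Rightarrow> 'w measure) \<Rightarrow> (real \<Rightarrow> 'w \<Rightarrow> 'a option) \<Rightarrow>
   (real \<Rightarrow> 'a \<Rightarrow> 'a \<Rightarrow> real) \<Rightarrow> bool" where
  "has_continuous_transition_density U P Z q \<longleftrightarrow> has_transition_density U P Z q \<and>
     continuous_on ({0<..} \<times> U \<times> U) (\<lambda>(t, x, y). q t x y)"

text \<open>For \<open>x \<in> U\<close>: the resolvent of a process \<open>Z\<close> in \<open>U \<union> {None}\<close>.\<close>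

definition resolvent ::
  "('a option \<Rightarrow> 'w measure) \<Rightarrow> (real \<Rightarrow> 'w \<Rightarrow> 'a option) \<Rightarrow> real \<Rightarrow> ('a \<Rightarrow> real) \<Rightarrow> 'a \<Rightarrow> real" where
  "resolvent P Z \<alpha> f x =
     (\<integral>\<omega>. (LINT t:{0..}|lborel. exp (- \<alpha> * t) * ext0 f (Z t \<omega>)) \<partial>P (Some x))"

definition strong_feller_resolvent ::
  "'a::euclidean_space set \<Rightarrow> ('a option \<Rightarrow> 'w measure) \<Rightarrow> (real \<Rightarrow> 'w \<Rightarrow> 'a option) \<Rightarrow> bool" where
  "strong_feller_resolvent U P Z \<longleftrightarrow>
     (\<forall>f \<alpha>. f \<in> borel_measurable (restrict_space borel U) \<longrightarrow> bounded (f ` U) \<longrightarrow> 0 \<le> \<alpha> \<longrightarrow>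
        continuous_on U (resolvent P Z \<alpha> f) \<and> bounded (resolvent P Z \<alpha> f ` U))"


section \<open>Stochastic integration and the diffusion X\<close>

text \<open>Convergence in probability is stated with measurable covers, since the measure of a
  non-measurable set is \<open>0\<close> by convention.\<close>

definition tends_to_0_in_prob :: "'w measure \<Rightarrow> (nat \<Rightarrow> 'w \<Rightarrow> ennreal) \<Rightarrow> bool" where
  "tends_to_0_in_prob P D \<longleftrightarrow> (\<forall>\<epsilon>>0. \<forall>\<delta>>0. eventually (\<lambda>n.
     \<exists>\<Lambda>\<in>sets P. {\<omega>\<in>space P. D n \<omega> > ennreal \<epsilon>} \<subseteq> \<Lambda> \<and> measure P \<Lambda> < \<delta>) sequentially)"

definition ucp_limit ::
  "'w measure \<Rightarrow> (nat \<Rightarrow> real \<Rightarrow> 'w \<Rightarrow> 'b::real_normed_vector) \<Rightarrow> (real \<Rightarrow> 'w \<Rightarrow> 'b) \<Rightarrow> bool" where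
  "ucp_limit P Z Z\<^sub>0 \<longleftrightarrow> (\<forall>T\<ge>0. tends_to_0_in_prob P
     (\<lambda>n \<omega>. SUP t\<in>{0..T}. ennreal (norm (Z n t \<omega> - Z\<^sub>0 t \<omega>))))"

definition brownian_motion ::
  "'w measure \<Rightarrow> (real \<Rightarrow> 'w measure) \<Rightarrow> (real \<Rightarrow> 'w \<Rightarrow> real^'d::finite) \<Rightarrow> bool" where
  "brownian_motion P F W \<longleftrightarrow>
     (AE \<omega> in P. W 0 \<omega> = 0) \<and> (AE \<omega> in P. continuous_on {0..} (\<lambda>t. W t \<omega>)) \<and>
     (\<forall>t\<ge>0. W t \<in> borel_measurable (F t)) \<and>
     (\<forall>s\<ge>0. \<forall>t>s.
        distr P borel (\<lambda>\<omega>. W t \<omega> - W s \<omega>) =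
          density lborel (\<lambda>y. ennreal (\<Prod>i\<in>UNIV. normal_density 0 (sqrt (t - s)) (y $ i))) \<and>
        (\<forall>\<Lambda>\<in>sets (F s). \<forall>B\<in>sets borel.
           measure P {\<omega>\<in>\<Lambda>. W t \<omega> - W s \<omega> \<in> B} =
           measure P \<Lambda> * measure P {\<omega>\<in>space P. W t \<omega> - W s \<omega> \<in> B}))"

text \<open>Simple integrands \<open>\<Sum>\<^sub>k \<xi>\<^sub>k 1\<^bsub>(u\<^sub>k, u\<^sub>k\<^sub>+\<^sub>1]\<^esub>\<close> with bounded \<open>\<F>(u\<^sub>k)\<close>-measurable matrices \<open>\<xi>\<^sub>k\<close>,
  and their integrals.\<close>

definition simple_integrand ::
  "(real \<Rightarrow> 'w measure) \<Rightarrow> nat \<Rightarrow> (nat \<Rightarrow> real) \<Rightarrow> (nat \<Rightarrow> 'w \<Rightarrow> real^'d::finite^'d) \<Rightarrow> bool" where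
  "simple_integrand F m u \<xi> \<longleftrightarrow> 0 \<le> u 0 \<and> incseq u \<and>
     (\<forall>k<m. \<xi> k \<in> borel_measurable (F (u k)) \<and> bounded (\<xi> k ` space (F (u k))))"

definition simple_value ::
  "nat \<Rightarrow> (nat \<Rightarrow> real) \<Rightarrow> (nat \<Rightarrow> 'w \<Rightarrow> real^'d::finite^'d) \<Rightarrow> real \<Rightarrow> 'w \<Rightarrow> real^'d^'d" where
  "simple_value m u \<xi> t \<omega> = (\<Sum>k<m. indicat_real {u k<..u (Suc k)} t *\<^sub>R \<xi> k \<omega>)"

definition simple_integral ::
  "nat \<Rightarrow> (nat \<Rightarrow> real) \<Rightarrow> (nat \<Rightarrow> 'w \<Rightarrow> real^'d::finite^'d) \<Rightarrow> (real \<Rightarrow> 'w \<Rightarrow> real^'d) \<Rightarrow>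
   real \<Rightarrow> 'w \<Rightarrow> real^'d" where
  "simple_integral m u \<xi> W t \<omega> =
     (\<Sum>k<m. \<xi> k \<omega> *v (W (min t (u (Suc k))) \<omega> - W (min t (u k)) \<omega>))"

text \<open>\<open>J\<close> is (a version of) the Ito integral \<open>\<integral> K dW\<close>, for progressively measurable \<open>K\<close> with
  locally square-integrable paths.\<close>

definition ito_integral ::
  "'w measure \<Rightarrow> (real \<Rightarrow> 'w measure) \<Rightarrow> (real \<Rightarrow> 'w \<Rightarrow> real^'d::finite) \<Rightarrow>
   (real \<Rightarrow> 'w \<Rightarrow> real^'d^'d) \<Rightarrow> (real \<Rightarrow> 'w \<Rightarrow> real^'d) \<Rightarrow> bool" where
  "ito_integral P F W K J \<longleftrightarrow>
     (AE \<omega> in P. continuous_on {0..} (\<lambda>t. J t \<omega>)) \<and>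
     (\<exists>m u \<xi>. (\<forall>n. simple_integrand F (m n) (u n) (\<xi> n)) \<and>
        (\<forall>T\<ge>0. tends_to_0_in_prob P (\<lambda>n \<omega>.
           \<integral>\<^sup>+t\<in>{0..T}. ennreal ((norm (simple_value (m n) (u n) (\<xi> n) t \<omega> - K t \<omega>))\<^sup>2) \<partial>lborel)) \<and>
        ucp_limit P (\<lambda>n. simple_integral (m n) (u n) (\<xi> n) W) J)"

text \<open>\<open>N\<close> is the additive functional of a path \<open>Z\<close> that represents the drift \<open>\<mu>\<close>.\<close>

definition singular_drift_functional ::
  "'w measure \<Rightarrow> (real^'d::finite \<Rightarrow> real) \<Rightarrow> ('d \<Rightarrow> (real^'d) signed_measure) \<Rightarrow>
   (real \<Rightarrow> 'w \<Rightarrow> real^'d) \<Rightarrow> (real \<Rightarrow> 'w \<Rightarrow> real^'d) \<Rightarrow> bool" where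
  "singular_drift_functional P \<phi> \<mu> Z N \<longleftrightarrow> (\<forall>j.
     ucp_limit P (\<lambda>n t \<omega>. LINT s:{0..t}|lborel. mollify \<phi> n (\<mu> j) (Z s \<omega>)) (\<lambda>t \<omega>. N t \<omega> $ j) \<and>
     (\<exists>\<kappa>. strict_mono \<kappa> \<and> (AE \<omega> in P. \<forall>t\<ge>0.
        bdd_above (range (\<lambda>k::nat. LINT s:{0..t}|lborel. \<bar>mollify \<phi> (\<kappa> k) (\<mu> j) (Z s \<omega>)\<bar>)))))"

definition solves_sde ::
  "operator_form \<Rightarrow> (real^'d::finite \<Rightarrow> real^'d^'d) \<Rightarrow> (real^'d \<Rightarrow> real) \<Rightarrow>
   ('d \<Rightarrow> (real^'d) signed_measure) \<Rightarrow> real^'d \<Rightarrow> 'w measure \<Rightarrow>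
   (real \<Rightarrow> 'w \<Rightarrow> (real^'d) option) \<Rightarrow> bool" where
  "solves_sde L A \<phi> \<mu> x P X \<longleftrightarrow> (\<exists>F W J N.
     filtration (space P) F \<and> (\<forall>t. sets (F t) \<subseteq> sets P) \<and>
     (\<forall>t\<ge>0. \<forall>B\<in>sets borel. {\<omega>\<in>space P. X t \<omega> \<in> Some ` B} \<in> sets (F t)) \<and>
     brownian_motion P F W \<and>
     ito_integral P F W (\<lambda>t \<omega>. matrix_sqrt (A (the (X t \<omega>)))) J \<and>
     singular_drift_functional P \<phi> \<mu> (\<lambda>t \<omega>. the (X t \<omega>)) N \<and>
     (AE \<omega> in P. \<forall>t\<ge>0. X t \<omega> =
        Some (x + J t \<omega> + (LINT s:{0..t}|lborel. first_order_drift L A (the (X s \<omega>))) + N t \<omega>)))"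

text \<open>The diffusion with generator formally \<open>L + \<mu> \<cdot> \<nabla>\<close>. It is conservative, because the equation
  forces \<open>X t \<noteq> None\<close> for all \<open>t\<close> almost surely.\<close>

definition singular_drift_diffusion ::
  "operator_form \<Rightarrow> (real^'d::finite \<Rightarrow> real^'d^'d) \<Rightarrow> (real^'d \<Rightarrow> real) \<Rightarrow>
   ('d \<Rightarrow> (real^'d) signed_measure) \<Rightarrow> ('w, real^'d) process \<Rightarrow> bool" where
  "singular_drift_diffusion L A \<phi> \<mu> X \<longleftrightarrow>
     hunt_process UNIV X \<and> continuous_process X \<and>
     (\<forall>x. solves_sde L A \<phi> \<mu> x (law X (Some x)) (path X))"


section \<open>Killing by an additive functional\<close>

text \<open>Positive continuous additive functionals of the process \<open>p\<close> killed on exiting \<open>V\<close>. As the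
  shift is that of \<open>p\<close> and not that of the killed process, the term \<open>A\<^sub>s \<circ> \<theta>\<^sub>t\<close> carries
  the factor \<open>1\<^bsub>t < \<tau>\<^esub>\<close>. Adaptedness is up to null sets, i.e. to the
  completed filtration of the killed process.\<close>

definition killed_pcaf ::
  "'a::euclidean_space set \<Rightarrow> ('w, 'a) process \<Rightarrow> (real \<Rightarrow> 'w \<Rightarrow> real) \<Rightarrow> bool" where
  "killed_pcaf V p A \<longleftrightarrow>
     (\<forall>t\<ge>0. A t \<in> borel_measurable (sample p)) \<and>
     (\<forall>x\<in>V.
        (\<forall>t\<ge>0. \<exists>g \<in> borel_measurable (natural_filtration (space (sample p)) (killed V (path p)) t).
           AE \<omega> in law p (Some x). A t \<omega> = g \<omega>) \<and>
        (AE \<omega> in law p (Some x).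
           A 0 \<omega> = 0 \<and> mono_on {0..} (\<lambda>t. A t \<omega>) \<and> continuous_on {0..} (\<lambda>t. A t \<omega>)) \<and>
        (\<forall>s\<ge>0. \<forall>t\<ge>0. AE \<omega> in law p (Some x).
           A (t + s) \<omega> = A t \<omega> +
             (if ereal t < exit_time V (path p) \<omega> then A s (shift p t \<omega>) else 0)))"

text \<open>\<open>A\<close> corresponds to the measure \<open>\<nu>\<close>, where \<open>q\<close> is the density of \<open>p\<close> killed on exiting \<open>V\<close>. The
  integral \<open>dA\<^sub>s\<close> is the Lebesgue-Stieltjes integral; \<open>max 0\<close> extends \<open>A\<close> constantly to
  negative times.\<close>

definition pcaf_of_measure ::
  "'a::euclidean_space set \<Rightarrow> ('w, 'a) process \<Rightarrow> (real \<Rightarrow> 'a \<Rightarrow> 'a \<Rightarrow> real) \<Rightarrow> 'a measure \<Rightarrow>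
   (real \<Rightarrow> 'w \<Rightarrow> real) \<Rightarrow> bool" where
  "pcaf_of_measure V p q \<nu> A \<longleftrightarrow>
     (\<forall>f :: 'a \<Rightarrow> real. f \<in> borel_measurable (restrict_space borel V) \<longrightarrow> bounded (f ` V) \<longrightarrow>
        (\<forall>y\<in>V. 0 \<le> f y) \<longrightarrow> (\<forall>x\<in>V. \<forall>t\<ge>0.
          (\<integral>\<^sup>+\<omega>. (\<integral>\<^sup>+s\<in>{0..t}. ennreal (ext0 f (killed V (path p) s \<omega>))
              \<partial>interval_measure (\<lambda>s. A (max 0 s) \<omega>)) \<partial>law p (Some x)) =
          (\<integral>\<^sup>+s\<in>{0<..t}. (\<integral>\<^sup>+y\<in>V. ennreal (q s x y * f y) \<partial>\<nu>) \<partial>lborel)))"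

text \<open>\<open>Y\<close> is the process \<open>p\<close>, killed on exiting \<open>V\<close>, further killed by \<open>exp (- A)\<close>.\<close>

definition killed_by_functional ::
  "'a::euclidean_space set \<Rightarrow> ('w, 'a) process \<Rightarrow> (real \<Rightarrow> 'w \<Rightarrow> real) \<Rightarrow> ('v, 'a) process \<Rightarrow> bool" where
  "killed_by_functional V p A Y \<longleftrightarrow> hunt_process V Y \<and> continuous_process Y \<and>
     (\<forall>f :: 'a \<Rightarrow> ennreal. f \<in> borel_measurable (restrict_space borel V) \<longrightarrow>
        (\<forall>x\<in>V. \<forall>t\<ge>0.
          (\<integral>\<^sup>+\<omega>. ext0 f (path Y t \<omega>) \<partial>law Y (Some x)) =
          (\<integral>\<^sup>+\<omega>. ennreal (exp (- A t \<omega>)) * ext0 f (killed V (path p) t \<omega>) \<partial>law p (Some x))))"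


section \<open>Green functions and the dual process\<close>

definition green :: "(real \<Rightarrow> 'a \<Rightarrow> 'a \<Rightarrow> real) \<Rightarrow> 'a \<Rightarrow> 'a \<Rightarrow> ennreal" where
  "green r x y = (\<integral>\<^sup>+t\<in>{0<..}. ennreal (r t x y) \<partial>lborel)"

text \<open>The conversion by \<open>enn2real\<close> sends \<open>\<infinity>\<close> to \<open>0\<close>; it is harmless where \<open>H > 0\<close>.\<close>

definition ref_weight ::
  "'a::euclidean_space set \<Rightarrow> (real \<Rightarrow> 'a \<Rightarrow> 'a \<Rightarrow> real) \<Rightarrow> 'a \<Rightarrow> real" where
  "ref_weight V r x = enn2real (\<integral>\<^sup>+y\<in>V. green r y x \<partial>lborel)"

definition ref_measure ::
  "'a::euclidean_space set \<Rightarrow> (real \<Rightarrow> 'a \<Rightarrow> 'a \<Rightarrow> real) \<Rightarrow> 'a measure" where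
  "ref_measure V r = density lborel (\<lambda>x. indicator V x * ennreal (ref_weight V r x))"

definition dual_density :: "('a \<Rightarrow> real) \<Rightarrow> (real \<Rightarrow> 'a \<Rightarrow> 'a \<Rightarrow> real) \<Rightarrow> real \<Rightarrow> 'a \<Rightarrow> 'a \<Rightarrow> real" where
  "dual_density H r t x y = r t y x * H y / H x"

definition in_duality ::
  "'a::euclidean_space set \<Rightarrow> 'a measure \<Rightarrow> ('v, 'a) process \<Rightarrow> ('u, 'a) process \<Rightarrow> bool" where
  "in_duality V \<xi> Y Yhat \<longleftrightarrow> (\<forall>t>0. \<forall>(f :: 'a \<Rightarrow> ennreal) (g :: 'a \<Rightarrow> ennreal).
     f \<in> borel_measurable borel \<longrightarrow> g \<in> borel_measurable borel \<longrightarrow>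
     (\<integral>\<^sup>+x\<in>V. f x * (\<integral>\<^sup>+\<omega>. ext0 g (path Y t \<omega>) \<partial>law Y (Some x)) \<partial>\<xi>) =
     (\<integral>\<^sup>+x\<in>V. g x * (\<integral>\<^sup>+\<omega>. ext0 f (path Yhat t \<omega>) \<partial>law Yhat (Some x)) \<partial>\<xi>))"

definition dual_process ::
  "'a::euclidean_space set \<Rightarrow> (real \<Rightarrow> 'a \<Rightarrow> 'a \<Rightarrow> real) \<Rightarrow> ('v, 'a) process \<Rightarrow> ('u, 'a) process \<Rightarrow> bool" where
  "dual_process V r Y Yhat \<longleftrightarrow>
     hunt_process V Yhat \<and> continuous_process Yhat \<and> transient_process V Yhat \<and>
     in_duality V (ref_measure V r) Y Yhat \<and>
     has_transition_density V (law Yhat) (path Yhat) (dual_density (ref_weight V r) r)"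

end

theory Submission
  imports Defs
begin

text \<open>
  The dual resolvent is an integral in space and time against the density of the killed process:
  \<open>G f x = (1 / H x) \<integral> exp (- \<alpha> t) f y H y r\<^sup>U(t, y, x) d(t, y)\<close> over \<open>{0<..} \<times> U\<close>. As \<open>H\<close> is continuous
  and positive on \<open>U\<close> and \<open>exp (- \<alpha> t) f y H y\<close> is bounded, it suffices that the functions
  \<open>(t, y) \<mapsto> r\<^sup>U(t, y, x)\<close> depend continuously on \<open>x\<close> in a way that permits passing to the limit under the
  integral. No estimate on the density is needed for this. By joint continuity \<open>r\<^sup>U(t, y, x\<^sub>n)\<close> and
  \<open>r\<^sup>V(t, y, x\<^sub>n)\<close> converge pointwise when \<open>x\<^sub>n\<close> converges in \<open>U\<close>; moreover \<open>0 \<le> r\<^sup>U \<le> r\<^sup>V\<close>; and the integral of the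
  majorant \<open>(t, y) \<mapsto> r\<^sup>V(t, y, x)\<close> over \<open>{0<..} \<times> V\<close> is exactly \<open>H x\<close>, which is finite and continuous.
  So the integrals of the majorants converge to the integral of their limit, and the dominated
  convergence theorem with varying majorants, a form of Scheffe's lemma, applies
  (\<open>general_dominated_convergence\<close>, \<open>continuous_on_space_time_integral\<close>). The same majorant gives the
  bound: in absolute value, the resolvent of \<open>f\<close> is at most \<open>sup \<bar>f\<bar> \<cdot> sup H \<cdot> H x / H x\<close>.

  The comparison \<open>r\<^sup>U \<le> r\<^sup>V\<close> (\<open>transition_density_mono\<close>) holds because killing at the exit from the smaller
  set decreases the transition probabilities, and continuity turns the almost everywhere inequality
  between the densities into a pointwise one.

  The formula for the resolvent (\<open>resolvent_killed_eq_space_time_integral\<close>) is Fubini's theorem. What has to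
  be checked is that the position of the killed process is jointly measurable in time and \<open>\<omega>\<close>. For
  this, the event that the exit time exceeds \<open>t\<close> is expressed by countably many conditions on the path
  (\<open>less_exit_time_iff_rational\<close>), using an exhaustion of \<open>U\<close> by compact sets, and the position before the
  exit is a limit of discretizations in time, by continuity of the paths up to the lifetime.
\<close>

section \<open>Dominated convergence with varying majorants\<close>

text \<open>The majorants \<open>G n\<close> converge in \<open>L\<^sup>1\<close> by Scheffe's lemma. Clipping \<open>s n\<close> to \<open>[- g, g]\<close> therefore
  changes its integral by an amount that tends to \<open>0\<close>, and the clipped functions have the fixed
  majorant \<open>g\<close>.\<close>

lemma general_dominated_convergence:
  fixes f g :: "'a \<Rightarrow> real" and s G :: "nat \<Rightarrow> 'a \<Rightarrow> real"
  assumes meas [measurable]: "f \<in> borel_measurable M" "\<And>n. s n \<in> borel_measurable M"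
    and int: "\<And>n. integrable M (G n)" "integrable M g"
    and lim_s: "\<And>x. x \<in> space M \<Longrightarrow> (\<lambda>n. s n x) \<longlonglongrightarrow> f x"
    and lim_G: "\<And>x. x \<in> space M \<Longrightarrow> (\<lambda>n. G n x) \<longlonglongrightarrow> g x"
    and bound: "\<And>n x. x \<in> space M \<Longrightarrow> \<bar>s n x\<bar> \<le> G n x"
    and lim_int: "(\<lambda>n. integral\<^sup>L M (G n)) \<longlonglongrightarrow> integral\<^sup>L M g"
  shows "(\<lambda>n. integral\<^sup>L M (s n)) \<longlonglongrightarrow> integral\<^sup>L M f"
proof -
  have [measurable]: "\<And>n. G n \<in> borel_measurable M" "g \<in> borel_measurable M"
    using int by auto
  have G0: "0 \<le> G n x" if "x \<in> space M" for n x
    using bound[OF that, of n] by linarith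
  have g0: "0 \<le> g x" if "x \<in> space M" for x
    using lim_G[OF that] G0[OF that] by (auto intro: LIMSEQ_le_const)
  have f_le: "\<bar>f x\<bar> \<le> g x" if "x \<in> space M" for x
    using LIMSEQ_le[OF tendsto_rabs[OF lim_s[OF that]] lim_G[OF that]] bound[OF that] by auto
  have nn: "(\<integral>\<^sup>+x. ennreal (norm (G n x)) \<partial>M) = ennreal (integral\<^sup>L M (G n))" for n
    using G0 by (subst nn_integral_eq_integral[symmetric])
      (auto simp: int intro!: nn_integral_cong)
  have nng: "(\<integral>\<^sup>+x. ennreal (norm (g x)) \<partial>M) = ennreal (integral\<^sup>L M g)"
    using g0 by (subst nn_integral_eq_integral[symmetric])
      (auto simp: int intro!: nn_integral_cong)
  have "(\<lambda>n. \<integral>\<^sup>+x. ennreal (norm (G n x)) \<partial>M) \<longlonglongrightarrow> (\<integral>\<^sup>+x. ennreal (norm (g x)) \<partial>M)"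
    unfolding nn nng by (intro tendsto_ennrealI lim_int)
  then have "limsup (\<lambda>n. \<integral>\<^sup>+x. ennreal (norm (G n x)) \<partial>M) \<le> (\<integral>\<^sup>+x. ennreal (norm (g x)) \<partial>M)"
    by (simp add: lim_imp_Limsup)
  with int lim_G have Scheffe: "(\<lambda>n. \<integral>\<^sup>+x. ennreal (norm (G n x - g x)) \<partial>M) \<longlonglongrightarrow> 0"
    by (intro Scheffe_lemma1) auto
  have "ennreal (integral\<^sup>L M (\<lambda>x. norm (G n x - g x))) = (\<integral>\<^sup>+x. ennreal (norm (G n x - g x)) \<partial>M)" for n
    using int by (intro nn_integral_eq_integral[symmetric]) auto
  with Scheffe have diff0: "(\<lambda>n. integral\<^sup>L M (\<lambda>x. norm (G n x - g x))) \<longlonglongrightarrow> 0"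
    by (subst tendsto_ennreal_iff[symmetric]) auto
  define c where "c n x = max (- g x) (min (g x) (s n x))" for n x
  have [measurable]: "\<And>n. c n \<in> borel_measurable M" unfolding c_def by measurable
  have c_le: "norm (c n x) \<le> g x" if "x \<in> space M" for n x
    using g0[OF that] unfolding c_def by (auto simp: max_def min_def)
  have c_int: "integrable M (c n)" for n
    by (rule Bochner_Integration.integrable_bound[OF int(2)]) (use c_le g0 in \<open>auto simp: abs_le_iff\<close>)
  have s_int: "integrable M (s n)" for n
    by (rule Bochner_Integration.integrable_bound[OF int(1)[of n]]) (use bound G0 in auto)
  have "(\<lambda>n. integral\<^sup>L M (c n)) \<longlonglongrightarrow> integral\<^sup>L M f"
  proof (rule integral_dominated_convergence[OF _ _ int(2)])
    show "AE x in M. (\<lambda>n. c n x) \<longlonglongrightarrow> f x"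
    proof (rule AE_I2)
      fix x assume x: "x \<in> space M"
      have "(\<lambda>n. c n x) \<longlonglongrightarrow> max (- g x) (min (g x) (f x))"
        unfolding c_def by (intro tendsto_intros lim_s x)
      then show "(\<lambda>n. c n x) \<longlonglongrightarrow> f x"
        using f_le[OF x] by (simp add: max_def min_def abs_le_iff split: if_splits)
    qed
  qed (use c_le in auto)
  moreover have "(\<lambda>n. integral\<^sup>L M (s n) - integral\<^sup>L M (c n)) \<longlonglongrightarrow> 0"
  proof (rule Lim_null_comparison[OF _ diff0], rule always_eventually, rule allI)
    fix n
    have "norm (integral\<^sup>L M (s n) - integral\<^sup>L M (c n)) = norm (\<integral>x. s n x - c n x \<partial>M)"
      using s_int c_int by simp
    also have "\<dots> \<le> (\<integral>x. norm (s n x - c n x) \<partial>M)"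
      by (rule integral_norm_bound)
    also have "\<dots> \<le> (\<integral>x. norm (G n x - g x) \<partial>M)"
    proof (rule integral_mono)
      fix x assume x: "x \<in> space M"
      show "norm (s n x - c n x) \<le> norm (G n x - g x)"
        using bound[OF x, of n] g0[OF x] unfolding c_def by (auto simp: max_def min_def)
    qed (use s_int c_int int in auto)
    finally show "norm (integral\<^sup>L M (s n) - integral\<^sup>L M (c n)) \<le> (\<integral>x. norm (G n x - g x) \<partial>M)" .
  qed
  ultimately show ?thesis
    using tendsto_add by fastforce
qed

section \<open>Space-time integrals of a transition density\<close>

text \<open>For a transition density \<open>p\<close> and a fixed end point \<open>x\<close>: the function \<open>(t, y) \<mapsto> p t y x\<close>, extended by
  \<open>0\<close> from \<open>{0<..} \<times> U\<close> to the whole of space-time. The variable of integration is the starting point.\<close>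

definition space_time_kernel ::
  "'a::euclidean_space set \<Rightarrow> (real \<Rightarrow> 'a \<Rightarrow> 'a \<Rightarrow> real) \<Rightarrow> 'a \<Rightarrow> real \<times> 'a \<Rightarrow> real" where
  "space_time_kernel U p x z = indicat_real ({0<..} \<times> U) z * p (fst z) (snd z) x"

lemma measurable_space_time_kernel:
  assumes "open U" "x \<in> U" and cont: "continuous_on ({0<..} \<times> U \<times> U) (\<lambda>(t, y, x). p t y x)"
  shows "space_time_kernel U p x \<in> borel_measurable (lborel \<Otimes>\<^sub>M lborel)"
proof -
  have "continuous_on ({0<..} \<times> U) ((\<lambda>(t, y, x). p t y x) \<circ> (\<lambda>z. (fst z, snd z, x)))"
    by (intro continuous_on_compose continuous_on_subset[OF cont] continuous_intros)
       (use assms in auto)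
  then have "(\<lambda>z. indicator ({0<..} \<times> U) z *\<^sub>R p (fst z) (snd z) x) \<in> borel_measurable borel"
    using assms(1) by (intro borel_measurable_continuous_on_indicator)
      (auto simp: o_def case_prod_unfold intro!: borel_open open_Times)
  moreover have "sets (lborel \<Otimes>\<^sub>M lborel) = sets (borel :: (real \<times> 'a) measure)"
    by (metis borel_prod sets_lborel sets_pair_measure_cong)
  ultimately show ?thesis
    by (simp add: space_time_kernel_def[abs_def] cong: measurable_cong_sets)
qed

lemma nn_integral_space_time_kernel:
  assumes "open U" "x \<in> U" "continuous_on ({0<..} \<times> U \<times> U) (\<lambda>(t, y, x). p t y x)"
  shows "(\<integral>\<^sup>+z. ennreal (space_time_kernel U p x z) \<partial>(lborel \<Otimes>\<^sub>M lborel)) =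
    (\<integral>\<^sup>+y\<in>U. green p y x \<partial>lborel)"
proof -
  note [measurable] = measurable_space_time_kernel[OF assms]
  have "(\<integral>\<^sup>+z. ennreal (space_time_kernel U p x z) \<partial>(lborel \<Otimes>\<^sub>M lborel)) =
      (\<integral>\<^sup>+y. (\<integral>\<^sup>+t. ennreal (space_time_kernel U p x (t, y)) \<partial>lborel) \<partial>lborel)"
    by (subst lborel_pair.nn_integral_snd) (auto simp: case_prod_unfold)
  also have "\<dots> = (\<integral>\<^sup>+y\<in>U. green p y x \<partial>lborel)"
    unfolding green_def space_time_kernel_def
    by (intro nn_integral_cong) (auto simp: indicator_def intro!: nn_integral_cong)
  finally show ?thesis .
qed

lemma space_time_kernel_integral:
  assumes U: "open U" "x \<in> U" and cont: "continuous_on ({0<..} \<times> U \<times> U) (\<lambda>(t, y, x). p t y x)"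
    and nonneg: "\<And>t y. 0 < t \<Longrightarrow> y \<in> U \<Longrightarrow> 0 \<le> p t y x"
    and h: "(\<integral>\<^sup>+y\<in>U. green p y x \<partial>lborel) = ennreal h" "0 \<le> h"
  shows "integrable (lborel \<Otimes>\<^sub>M lborel) (space_time_kernel U p x)"
    and "integral\<^sup>L (lborel \<Otimes>\<^sub>M lborel) (space_time_kernel U p x) = h"
proof -
  have nn: "0 \<le> space_time_kernel U p x z" for z
    using nonneg by (auto simp: space_time_kernel_def indicator_def)
  show int: "integrable (lborel \<Otimes>\<^sub>M lborel) (space_time_kernel U p x)"
    using nn by (intro integrableI_nonneg measurable_space_time_kernel assms)
      (auto simp: nn_integral_space_time_kernel[OF U cont] h)
  show "integral\<^sup>L (lborel \<Otimes>\<^sub>M lborel) (space_time_kernel U p x) = h"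
    using nn_integral_eq_integral[OF int] nn h
    by (auto simp: nn_integral_space_time_kernel[OF U cont] intro!: integral_nonneg_AE)
qed

lemma space_time_kernel_mono:
  assumes "U \<subseteq> V" "x \<in> U"
    and "\<And>t y. 0 < t \<Longrightarrow> y \<in> U \<Longrightarrow> 0 \<le> p t y x \<and> p t y x \<le> P t y x"
    and "\<And>t y. 0 < t \<Longrightarrow> y \<in> V \<Longrightarrow> 0 \<le> P t y x"
  shows "0 \<le> space_time_kernel U p x z" "space_time_kernel U p x z \<le> space_time_kernel V P x z"
  using assms by (auto simp: space_time_kernel_def indicator_def)

text \<open>The key step. Nothing is assumed about the size of \<open>p\<close> except a majorant \<open>P\<close> whose space-time
  integral \<open>h x\<close> is finite and depends continuously on the end point \<open>x\<close>.\<close>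

lemma continuous_on_space_time_integral:
  fixes p P :: "real \<Rightarrow> 'a::euclidean_space \<Rightarrow> 'a \<Rightarrow> real"
  assumes U: "open U" "open V" "U \<subseteq> V"
    and contp: "continuous_on ({0<..} \<times> U \<times> U) (\<lambda>(t, y, x). p t y x)"
    and contP: "continuous_on ({0<..} \<times> V \<times> V) (\<lambda>(t, y, x). P t y x)"
    and p: "\<And>t y x. 0 < t \<Longrightarrow> y \<in> U \<Longrightarrow> x \<in> U \<Longrightarrow> 0 \<le> p t y x \<and> p t y x \<le> P t y x"
    and P: "\<And>t y x. 0 < t \<Longrightarrow> y \<in> V \<Longrightarrow> x \<in> V \<Longrightarrow> 0 \<le> P t y x"
    and h: "\<And>x. x \<in> U \<Longrightarrow> (\<integral>\<^sup>+y\<in>V. green P y x \<partial>lborel) = ennreal (h x)"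
      "\<And>x. x \<in> U \<Longrightarrow> 0 \<le> h x" "continuous_on U h"
    and g: "g \<in> borel_measurable (lborel \<Otimes>\<^sub>M lborel)" "\<And>z. \<bar>g z\<bar> \<le> C"
  shows "continuous_on U (\<lambda>x. \<integral>z. g z * space_time_kernel U p x z \<partial>(lborel \<Otimes>\<^sub>M lborel))"
proof (rule continuous_on_sequentiallyI)
  fix u a assume u: "\<forall>n. u n \<in> U" "a \<in> U" "u \<longlonglongrightarrow> a"
  note [measurable] = g(1) measurable_space_time_kernel[OF U(1) _ contp]
  have C: "0 \<le> C" using g(2)[of undefined] by linarith
  have lim_kernel: "(\<lambda>n. space_time_kernel W k (u n) z) \<longlonglongrightarrow> space_time_kernel W k a z"
    if "U \<subseteq> W" and cont: "continuous_on ({0<..} \<times> W \<times> W) (\<lambda>(t, y, x). k t y x)" for W k z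
  proof (cases "z \<in> {0<..} \<times> W")
    case True
    have "continuous_on W ((\<lambda>(t, y, x). k t y x) \<circ> (\<lambda>x. (fst z, snd z, x)))"
      by (intro continuous_on_compose continuous_on_subset[OF cont] continuous_intros)
         (use True in auto)
    then have "(\<lambda>n. k (fst z) (snd z) (u n)) \<longlonglongrightarrow> k (fst z) (snd z) a"
      using u \<open>U \<subseteq> W\<close> by (auto simp: o_def case_prod_unfold continuous_on_sequentially)
    then show ?thesis by (auto simp: space_time_kernel_def intro!: tendsto_intros)
  qed (simp add: space_time_kernel_def)
  have int: "integrable (lborel \<Otimes>\<^sub>M lborel) (space_time_kernel V P x)"
      "integral\<^sup>L (lborel \<Otimes>\<^sub>M lborel) (space_time_kernel V P x) = h x" if "x \<in> U" for x
    using that U P h by (auto intro!: space_time_kernel_integral contP)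
  have le: "0 \<le> space_time_kernel U p x z" "space_time_kernel U p x z \<le> space_time_kernel V P x z"
    if "x \<in> U" for x z
    using U p P that space_time_kernel_mono[of U V x p P z] by auto
  show "(\<lambda>n. \<integral>z. g z * space_time_kernel U p (u n) z \<partial>(lborel \<Otimes>\<^sub>M lborel))
      \<longlonglongrightarrow> (\<integral>z. g z * space_time_kernel U p a z \<partial>(lborel \<Otimes>\<^sub>M lborel))"
  proof (rule general_dominated_convergence
      [where G = "\<lambda>n z. C * space_time_kernel V P (u n) z" and g = "\<lambda>z. C * space_time_kernel V P a z"])
    show "(\<lambda>n. \<integral>z. C * space_time_kernel V P (u n) z \<partial>(lborel \<Otimes>\<^sub>M lborel))
        \<longlonglongrightarrow> (\<integral>z. C * space_time_kernel V P a z \<partial>(lborel \<Otimes>\<^sub>M lborel))"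
      using h(3) u by (auto simp: int continuous_on_sequentially o_def intro!: tendsto_intros)
    show "\<bar>g z * space_time_kernel U p (u n) z\<bar> \<le> C * space_time_kernel V P (u n) z" for n z
      using le[of "u n" z] u g(2)[of z] C by (auto simp: abs_mult intro!: mult_mono)
  qed (use u U int contp contP in \<open>auto intro!: tendsto_intros lim_kernel\<close>)
qed

section \<open>Paths of a Hunt process before the exit from an open set\<close>

lemma hunt_processD:
  assumes "hunt_process V Z"
  shows "\<forall>z. prob_space (law Z z) \<and> space (law Z z) = space (sample Z) \<and> sets (law Z z) = sets (sample Z)"
    and "\<forall>t\<ge>0. \<forall>\<omega>\<in>space (sample Z). path Z t \<omega> \<in> insert None (Some ` V)"
    and "\<forall>t\<ge>0. \<forall>B\<in>sets borel. {\<omega>\<in>space (sample Z). path Z t \<omega> \<in> Some ` B} \<in> sets (sample Z)"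
    and "\<forall>\<omega>\<in>space (sample Z). \<forall>s\<ge>0. \<forall>t\<ge>s. path Z s \<omega> = None \<longrightarrow> path Z t \<omega> = None"
    and "\<forall>\<omega>\<in>space (sample Z). \<forall>t\<ge>0. limitin (Alexandroff_compactification (top_of_set V))
           (\<lambda>s. path Z s \<omega>) (path Z t \<omega>) (at_right t)"
proof -
  note h = assms[unfolded hunt_process_def]
  note h2 = h[THEN conjunct2] note h3 = h2[THEN conjunct2] note h4 = h3[THEN conjunct2]
  note h5 = h4[THEN conjunct2] note h6 = h5[THEN conjunct2] note h7 = h6[THEN conjunct2]
  note h8 = h7[THEN conjunct2]
  show "\<forall>z. prob_space (law Z z) \<and> space (law Z z) = space (sample Z) \<and> sets (law Z z) = sets (sample Z)"
    by (rule h[THEN conjunct1])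
  show "\<forall>t\<ge>0. \<forall>\<omega>\<in>space (sample Z). path Z t \<omega> \<in> insert None (Some ` V)"
    by (rule h2[THEN conjunct1])
  show "\<forall>t\<ge>0. \<forall>B\<in>sets borel. {\<omega>\<in>space (sample Z). path Z t \<omega> \<in> Some ` B} \<in> sets (sample Z)"
    by (rule h3[THEN conjunct1])
  show "\<forall>\<omega>\<in>space (sample Z). \<forall>s\<ge>0. \<forall>t\<ge>s. path Z s \<omega> = None \<longrightarrow> path Z t \<omega> = None"
    by (rule h7[THEN conjunct1])
  show "\<forall>\<omega>\<in>space (sample Z). \<forall>t\<ge>0. limitin (Alexandroff_compactification (top_of_set V))
           (\<lambda>s. path Z s \<omega>) (path Z t \<omega>) (at_right t)"
    by (rule h8[THEN conjunct1])
qed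

lemma in_Some_image_iff: "z \<in> Some ` B \<longleftrightarrow> z \<noteq> None \<and> the z \<in> B"
  by (cases z) auto

text \<open>Right continuity in the one-point compactification keeps the path in an open set for a short time;
  in particular it does not jump immediately to the cemetery.\<close>

lemma hunt_right_open:
  assumes hunt: "hunt_process V Z" and \<omega>: "\<omega> \<in> space (sample Z)"
    and W: "open W" "W \<subseteq> V" and t: "0 \<le> t" "path Z t \<omega> \<in> Some ` W"
  shows "\<exists>e>0. \<forall>s. t \<le> s \<longrightarrow> s < t + e \<longrightarrow> path Z s \<omega> \<in> Some ` W"
proof -
  have "limitin (Alexandroff_compactification (top_of_set V)) (\<lambda>s. path Z s \<omega>) (path Z t \<omega>) (at_right t)"
    by (rule hunt_processD(5)[OF hunt, rule_format, OF \<omega> t(1)])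
  moreover have "openin (Alexandroff_compactification (top_of_set V)) (Some ` W)"
    using openin_open_Int[OF W(1), of V] W(2) by (simp add: Int_absorb1)
  ultimately have "eventually (\<lambda>s. path Z s \<omega> \<in> Some ` W) (at_right t)"
    using t(2) unfolding limitin_def by blast
  then obtain b where b: "t < b" "\<And>s. t < s \<Longrightarrow> s < b \<Longrightarrow> path Z s \<omega> \<in> Some ` W"
    unfolding eventually_at_right_field by blast
  show ?thesis
  proof (intro exI[of _ "b - t"] conjI allI impI)
    fix s assume "t \<le> s" "s < t + (b - t)"
    then show "path Z s \<omega> \<in> Some ` W"
      using b(2)[of s] t(2) by (cases "s = t") simp_all
  qed (use b in simp)
qed

lemma hunt_absorbing:
  assumes "hunt_process V Z" "\<omega> \<in> space (sample Z)" "0 \<le> s" "s \<le> t" "path Z t \<omega> \<noteq> None"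
  shows "path Z s \<omega> \<noteq> None"
  using hunt_processD(4)[OF assms(1), rule_format, OF assms(2-4)] assms(5) by blast

lemma hunt_state:
  assumes "hunt_process V Z" "\<omega> \<in> space (sample Z)" "0 \<le> t" "path Z t \<omega> \<noteq> None"
  shows "path Z t \<omega> \<in> Some ` V"
  using hunt_processD(2)[OF assms(1), rule_format, OF assms(3,2)] assms(4) by blast

lemma hunt_measurable_event:
  assumes "hunt_process V Z" "0 \<le> t" "B \<in> sets borel"
  shows "{\<omega>\<in>space (sample Z). path Z t \<omega> \<in> Some ` B} \<in> sets (sample Z)"
  by (rule hunt_processD(3)[OF assms(1), rule_format, OF assms(2,3)])

lemma hunt_law:
  assumes "hunt_process V Z"
  shows "prob_space (law Z z)" "space (law Z z) = space (sample Z)" "sets (law Z z) = sets (sample Z)"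
  using hunt_processD(1)[OF assms] by blast+

lemma less_exit_time_iff:
  assumes hunt: "hunt_process V Z" and \<omega>: "\<omega> \<in> space (sample Z)"
    and U: "open U" "U \<subseteq> V" and t: "0 < t"
  shows "ereal t < exit_time U (path Z) \<omega> \<longleftrightarrow> (\<forall>s. 0 < s \<longrightarrow> s \<le> t \<longrightarrow> path Z s \<omega> \<in> Some ` U)"
proof
  assume less: "ereal t < exit_time U (path Z) \<omega>"
  show "\<forall>s. 0 < s \<longrightarrow> s \<le> t \<longrightarrow> path Z s \<omega> \<in> Some ` U"
  proof (intro allI impI, rule ccontr)
    fix s assume "0 < s" "s \<le> t" "path Z s \<omega> \<notin> Some ` U"
    then have "exit_time U (path Z) \<omega> \<le> ereal s"
      unfolding exit_time_def by (intro Inf_lower imageI) simp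
    with less have "ereal t < ereal s" by (rule less_le_trans)
    with \<open>s \<le> t\<close> show False by simp
  qed
next
  assume in_U: "\<forall>s. 0 < s \<longrightarrow> s \<le> t \<longrightarrow> path Z s \<omega> \<in> Some ` U"
  from this[rule_format, OF t order_refl] have "path Z t \<omega> \<in> Some ` U" .
  then obtain e where e: "e > 0" "\<And>s. t \<le> s \<Longrightarrow> s < t + e \<Longrightarrow> path Z s \<omega> \<in> Some ` U"
    using hunt_right_open[OF hunt \<omega> U less_imp_le[OF t]] by blast
  have "ereal (t + e) \<le> exit_time U (path Z) \<omega>"
    unfolding exit_time_def
  proof (intro Inf_greatest, clarsimp)
    fix s assume "0 < s" "path Z s \<omega> \<notin> Some ` U"
    with in_U have "\<not> s \<le> t" by blast
    moreover have "\<not> (t \<le> s \<and> s < t + e)"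
      using e(2)[of s] \<open>path Z s \<omega> \<notin> Some ` U\<close> by blast
    ultimately show "t + e \<le> s" by linarith
  qed
  then show "ereal t < exit_time U (path Z) \<omega>"
    using less_le_trans[of "ereal t" "ereal (t + e)"] e(1) by simp
qed

lemma less_lifetime:
  assumes hunt: "hunt_process V Z" and \<omega>: "\<omega> \<in> space (sample Z)"
    and V: "open V" and t: "0 \<le> t" "path Z t \<omega> \<noteq> None"
  shows "ereal t < lifetime (path Z) \<omega>"
proof -
  obtain e where e: "e > 0" "\<And>s. t \<le> s \<Longrightarrow> s < t + e \<Longrightarrow> path Z s \<omega> \<in> Some ` V"
    using hunt_right_open[OF hunt \<omega> V subset_refl t(1) hunt_state[OF hunt \<omega> t]] by blast
  have "ereal (t + e) \<le> lifetime (path Z) \<omega>"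
    unfolding lifetime_def
  proof (intro Inf_greatest, clarsimp)
    fix s assume s: "0 \<le> s" "path Z s \<omega> = None"
    have "t < s"
      using hunt_absorbing[OF hunt \<omega> s(1) _ t(2)] s(2) by (meson not_le)
    moreover have "path Z s \<omega> \<notin> Some ` V" using s(2) by auto
    ultimately show "t + e \<le> s"
      using e(2)[of s] by (cases "s < t + e") simp_all
  qed
  then show ?thesis
    using less_le_trans[of "ereal t" "ereal (t + e)"] e(1) by simp
qed

text \<open>Only for \<open>t > 0\<close>: the exit time ignores the position at time \<open>0\<close>.\<close>

lemma killed_whole_space:
  assumes hunt: "hunt_process V Z" and \<omega>: "\<omega> \<in> space (sample Z)" and V: "open V" and t: "0 < t"
  shows "killed V (path Z) t \<omega> = path Z t \<omega>"
proof (cases "path Z t \<omega> = None")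
  case False
  have "path Z s \<omega> \<in> Some ` V" if "0 < s" "s \<le> t" for s
    using that by (intro hunt_state[OF hunt \<omega>] hunt_absorbing[OF hunt \<omega> _ _ False]) simp_all
  then have "ereal t < exit_time V (path Z) \<omega>"
    unfolding less_exit_time_iff[OF hunt \<omega> V subset_refl t] by blast
  then show ?thesis by (simp add: killed_def)
qed (simp add: killed_def)

lemma killed_eq:
  assumes hunt: "hunt_process V Z" and \<omega>: "\<omega> \<in> space (sample Z)"
    and U: "open U" "U \<subseteq> V" and t: "0 < t"
  shows "killed U (path Z) t \<omega> =
    (if ereal t < exit_time U (path Z) \<omega> then Some (the (path Z t \<omega>)) else None)"
    and "ereal t < exit_time U (path Z) \<omega> \<Longrightarrow> the (path Z t \<omega>) \<in> U"
proof -
  have "path Z t \<omega> \<in> Some ` U" if "ereal t < exit_time U (path Z) \<omega>"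
    using less_exit_time_iff[OF assms, THEN iffD1, OF that, rule_format, OF t order_refl] .
  then show "killed U (path Z) t \<omega> =
      (if ereal t < exit_time U (path Z) \<omega> then Some (the (path Z t \<omega>)) else None)"
    and "ereal t < exit_time U (path Z) \<omega> \<Longrightarrow> the (path Z t \<omega>) \<in> U"
    by (simp_all add: killed_def in_Some_image_iff)
qed

text \<open>A path which stays in \<open>U\<close> during \<open>(0, t]\<close> stays in one of the compact sets \<open>C m\<close> during
  \<open>[t / (n + 2), t]\<close>, for each \<open>n\<close>; as \<open>C m\<close> is closed and the path is continuous, this can be tested at rational
  times. The interval has to stay away from \<open>0\<close> because the starting point need not be in \<open>U\<close>.
  The separate condition at time \<open>t\<close> ensures that the path is alive, hence continuous, on \<open>[0, t]\<close>.\<close>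

lemma less_exit_time_iff_rational:
  assumes hunt: "hunt_process V Z" and cont: "continuous_process Z" and V: "open V"
    and U: "open U" "U \<subseteq> V" and t: "0 < t" and \<omega>: "\<omega> \<in> space (sample Z)"
    and C: "\<And>n. compact (C n)" "\<And>n. C n \<subseteq> U"
      "\<And>K. compact K \<Longrightarrow> K \<subseteq> U \<Longrightarrow> \<exists>N. \<forall>n\<ge>N. K \<subseteq> C n"
  shows "ereal t < exit_time U (path Z) \<omega> \<longleftrightarrow> path Z t \<omega> \<in> Some ` U \<and>
    (\<forall>n. \<exists>m::nat. \<forall>s \<in> {t / real (n + 2)<..<t} \<inter> \<rat>. path Z s \<omega> \<in> Some ` C m)" (is "?L \<longleftrightarrow> ?R")
proof -
  have path_cont: "continuous_on {0..t} (\<lambda>s. the (path Z s \<omega>))" if "path Z t \<omega> \<noteq> None"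
  proof (rule continuous_on_subset)
    show "continuous_on {s. 0 \<le> s \<and> ereal s < lifetime (path Z) \<omega>} (\<lambda>s. the (path Z s \<omega>))"
      using cont \<omega> by (simp add: continuous_process_def)
    show "{0..t} \<subseteq> {s. 0 \<le> s \<and> ereal s < lifetime (path Z) \<omega>}"
    proof
      fix s assume "s \<in> {0..t}"
      then show "s \<in> {s. 0 \<le> s \<and> ereal s < lifetime (path Z) \<omega>}"
        using le_less_trans[OF _ less_lifetime[OF hunt \<omega> V less_imp_le[OF t] that], of "ereal s"] by simp
    qed
  qed
  show ?thesis
  proof
    assume ?L
    then have in_U: "path Z s \<omega> \<in> Some ` U" if "0 < s" "s \<le> t" for s
      unfolding less_exit_time_iff[OF hunt \<omega> U t] using that by blast
    have bounded_away: "\<exists>m. \<forall>s \<in> {t / real (n + 2)<..<t} \<inter> \<rat>. path Z s \<omega> \<in> Some ` C m" for n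
    proof -
      let ?I = "{t / real (n + 2)..t}"
      have pos: "0 < t / real (n + 2)" using t by simp
      have sub: "?I \<subseteq> {0<..t}" using pos by auto
      have "path Z t \<omega> \<noteq> None" using in_U[OF t order_refl] by (simp add: in_Some_image_iff)
      then have "compact ((\<lambda>s. the (path Z s \<omega>)) ` ?I)"
        using sub by (intro compact_continuous_image continuous_on_subset[OF path_cont]) auto
      moreover have "(\<lambda>s. the (path Z s \<omega>)) ` ?I \<subseteq> U"
      proof (rule image_subsetI)
        fix s assume "s \<in> ?I"
        then have "0 < s" "s \<le> t" using pos by auto
        from in_U[OF this] show "the (path Z s \<omega>) \<in> U" by (simp add: in_Some_image_iff)
      qed
      ultimately obtain m where m: "(\<lambda>s. the (path Z s \<omega>)) ` ?I \<subseteq> C m"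
        using C(3)[of "(\<lambda>s. the (path Z s \<omega>)) ` ?I"] by (meson order_refl)
      have "path Z s \<omega> \<in> Some ` C m" if "s \<in> ?I" for s
      proof -
        have "0 < s" "s \<le> t" using that pos by auto
        from in_U[OF this] show ?thesis
          using subsetD[OF m imageI[OF that]] by (simp add: in_Some_image_iff)
      qed
      then show ?thesis by (intro exI[of _ m] ballI) simp
    qed
    show ?R by (intro conjI allI in_U[OF t order_refl] bounded_away)
  next
    assume R: ?R
    show ?L
      unfolding less_exit_time_iff[OF hunt \<omega> U t]
    proof (intro allI impI)
      fix s assume s: "0 < s" "s \<le> t"
      have nonNone: "path Z t \<omega> \<noteq> None" using R by (simp add: in_Some_image_iff)
      obtain n where n: "t / s < real n" using reals_Archimedean2 by blast
      have "t < real n * s" using n s by (simp add: pos_divide_less_eq)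
      also have "\<dots> \<le> real (n + 2) * s" using s by (intro mult_right_mono) auto
      finally have ns: "t / real (n + 2) < s" by (simp add: pos_divide_less_eq mult.commute)
      let ?I = "{t / real (n + 2)<..<t}"
      have less_t: "t / real (n + 2) < t" using ns s by linarith
      obtain m where m: "\<And>u. u \<in> ?I \<inter> \<rat> \<Longrightarrow> path Z u \<omega> \<in> Some ` C m"
        using R[THEN conjunct2, rule_format, of n] by metis
      have "closure (?I \<inter> \<rat>) = closure ?I"
        by (rule closure_open_Int_superset) (simp_all add: Rats_closure_real)
      then have cl: "closure (?I \<inter> \<rat>) = {t / real (n + 2)..t}"
        using less_t by simp
      have pos: "0 < t / real (n + 2)" using t by simp
      have "(\<lambda>u. the (path Z u \<omega>)) ` closure (?I \<inter> \<rat>) \<subseteq> C m"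
      proof (rule image_closure_subset)
        show "continuous_on (closure (?I \<inter> \<rat>)) (\<lambda>u. the (path Z u \<omega>))"
          unfolding cl using pos by (intro continuous_on_subset[OF path_cont[OF nonNone]]) auto
        show "closed (C m)" using C(1) by (rule compact_imp_closed)
        show "(\<lambda>u. the (path Z u \<omega>)) ` (?I \<inter> \<rat>) \<subseteq> C m"
        proof (rule image_subsetI)
          fix u assume "u \<in> ?I \<inter> \<rat>"
          from m[OF this] show "the (path Z u \<omega>) \<in> C m" by (simp add: in_Some_image_iff)
        qed
      qed
      moreover have "s \<in> closure (?I \<inter> \<rat>)"
        unfolding cl using ns s by simp
      ultimately have "the (path Z s \<omega>) \<in> U"
        using C(2)[of m] by (meson image_subset_iff subsetD)
      moreover have "path Z s \<omega> \<noteq> None"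
        using s(1) by (intro hunt_absorbing[OF hunt \<omega> _ s(2) nonNone]) simp
      ultimately show "path Z s \<omega> \<in> Some ` U" by (simp add: in_Some_image_iff)
    qed
  qed
qed

section \<open>Joint measurability of the killed process\<close>

lemma measurable_less_exit_time:
  assumes hunt: "hunt_process V Z" and cont: "continuous_process Z" and V: "open V"
    and U: "open U" "U \<subseteq> V" and t: "0 < t"
  shows "{\<omega>\<in>space (sample Z). ereal t < exit_time U (path Z) \<omega>} \<in> sets (sample Z)"
proof -
  obtain C where C: "\<And>n. compact (C n)" "\<And>n. C n \<subseteq> U"
      "\<And>n. C n \<subseteq> interior (C (Suc n))" "\<Union>(range C) = U"
      "\<And>K. compact K \<Longrightarrow> K \<subseteq> U \<Longrightarrow> \<exists>N. \<forall>n\<ge>N. K \<subseteq> C n"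
    by (rule open_Union_compact_subsets[OF U(1)]) (rule that; simp)
  have ev: "{\<omega>\<in>space (sample Z). path Z s \<omega> \<in> Some ` B} \<in> sets (sample Z)"
    if "0 < s" "B \<in> sets borel" for s B
    using hunt_measurable_event[OF hunt _ that(2), of s] that by simp
  have pos: "0 < s" if "s \<in> {t / real (n + 2)<..<t} \<inter> \<rat>" for s n
  proof -
    have "0 < t / real (n + 2)" using t by simp
    also have "\<dots> < s" using that by simp
    finally show ?thesis .
  qed
  have "{\<omega>\<in>space (sample Z). path Z t \<omega> \<in> Some ` U \<and>
    (\<forall>n. \<exists>m::nat. \<forall>s \<in> {t / real (n + 2)<..<t} \<inter> \<rat>. path Z s \<omega> \<in> Some ` C m)} \<in> sets (sample Z)"
    using t U C(1) pos
    by (intro sets.sets_Collect_conj sets.sets_Collect_countable_All sets.sets_Collect_countable_Ex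
          sets.sets_Collect_countable_All' ev)
       (auto simp del: of_nat_add intro!: countable_Int2 countable_rat borel_compact)
  then show ?thesis
    using less_exit_time_iff_rational[OF hunt cont V U t _ C(1,2,5)] by (simp cong: conj_cong)
qed

text \<open>The value \<open>the None\<close> is some fixed point, so that the position is Borel measurable on the
  whole sample space.\<close>

lemma measurable_position:
  assumes hunt: "hunt_process V Z" and t: "0 \<le> t"
  shows "(\<lambda>\<omega>. the (path Z t \<omega>)) \<in> borel_measurable (sample Z)"
proof (rule measurableI)
  fix B :: "'a set" assume B: "B \<in> sets borel"
  have "(\<lambda>\<omega>. the (path Z t \<omega>)) -` B \<inter> space (sample Z) =
      {\<omega>\<in>space (sample Z). path Z t \<omega> \<in> Some ` B} \<union>
      (if the None \<in> B then space (sample Z) - {\<omega>\<in>space (sample Z). path Z t \<omega> \<in> Some ` UNIV} else {})"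
    by (auto simp: image_iff) (metis option.collapse)+
  also have "\<dots> \<in> sets (sample Z)"
    using hunt_measurable_event[OF hunt t B] hunt_measurable_event[OF hunt t, of UNIV] by auto
  finally show "(\<lambda>\<omega>. the (path Z t \<omega>)) -` B \<inter> space (sample Z) \<in> sets (sample Z)" .
qed simp

text \<open>The set of pairs \<open>(t, \<omega>)\<close> with \<open>0 < t\<close> and \<open>t\<close> smaller than the exit time from \<open>U\<close>. For \<open>t > 0\<close> these
  are the pairs at which the process killed on exiting \<open>U\<close> is alive; time \<open>0\<close> is left out.\<close>

definition before_exit :: "('w, 'a) process \<Rightarrow> 'a set \<Rightarrow> (real \<times> 'w) set" where
  "before_exit Z U = {(t, \<omega>). 0 < t \<and> \<omega> \<in> space (sample Z) \<and> ereal t < exit_time U (path Z) \<omega>}"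

lemma sets_before_exit:
  assumes hunt: "hunt_process V Z" and cont: "continuous_process Z" and V: "open V"
    and U: "open U" "U \<subseteq> V"
  shows "before_exit Z U \<in> sets (lborel \<Otimes>\<^sub>M sample Z)"
proof -
  have "before_exit Z U = (\<Union>a\<in>{a\<in>\<rat>. 0 < a}. {0<..<a} \<times> {\<omega>\<in>space (sample Z). ereal a < exit_time U (path Z) \<omega>})"
    (is "_ = ?R")
  proof (intro set_eqI iffI)
    fix z assume "z \<in> before_exit Z U"
    then obtain t \<omega> where z: "z = (t, \<omega>)" "0 < t" "\<omega> \<in> space (sample Z)" "ereal t < exit_time U (path Z) \<omega>"
      by (auto simp: before_exit_def)
    obtain b where b: "t < b" "ereal b < exit_time U (path Z) \<omega>"
      using ereal_dense2[OF z(4)] by auto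
    obtain a where "a \<in> \<rat>" "t < a" "a < b" using Rats_dense_in_real[OF b(1)] by blast
    moreover have "ereal a < exit_time U (path Z) \<omega>"
      using \<open>a < b\<close> b(2) less_trans[of "ereal a" "ereal b"] by simp
    ultimately show "z \<in> ?R" using z by auto
  next
    fix z assume "z \<in> ?R"
    then obtain a t \<omega> where z: "z = (t, \<omega>)" "0 < t" "t < a" "\<omega> \<in> space (sample Z)"
        "ereal a < exit_time U (path Z) \<omega>"
      by auto
    then have "ereal t < exit_time U (path Z) \<omega>"
      using less_trans[of "ereal t" "ereal a"] by simp
    with z show "z \<in> before_exit Z U" by (simp add: before_exit_def)
  qed
  also have "\<dots> \<in> sets (lborel \<Otimes>\<^sub>M sample Z)"
  proof (rule sets.countable_UN'')
    show "countable {a \<in> \<rat>. 0 < (a::real)}"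
      by (rule countable_subset[OF _ countable_rat]) auto
    fix a :: real assume "a \<in> {a \<in> \<rat>. 0 < a}"
    then show "{0<..<a} \<times> {\<omega>\<in>space (sample Z). ereal a < exit_time U (path Z) \<omega>} \<in> sets (lborel \<Otimes>\<^sub>M sample Z)"
      by (intro pair_measureI measurable_less_exit_time[OF hunt cont V U]) simp_all
  qed
  finally show ?thesis .
qed

lemma measurable_position_before_exit:
  assumes hunt: "hunt_process V Z" and cont: "continuous_process Z" and V: "open V"
    and U: "open U" "U \<subseteq> V"
  shows "(\<lambda>(t, \<omega>). indicat_real (before_exit Z U) (t, \<omega>) *\<^sub>R the (path Z t \<omega>))
    \<in> borel_measurable (lborel \<Otimes>\<^sub>M sample Z)"
proof -
  note [measurable] = sets_before_exit[OF assms]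
  \<comment> \<open>The approximation of \<open>t\<close> from the right by multiples of \<open>1 / (n + 1)\<close>; \<open>max 0\<close> only matters for \<open>t < 0\<close>.\<close>
  define \<sigma> where "\<sigma> n t = max 0 ((real_of_int \<lfloor>real (Suc n) * t\<rfloor> + 1) / real (Suc n))" for n t
  have meas: "(\<lambda>z. indicat_real (before_exit Z U) z *\<^sub>R the (path Z (\<sigma> n (fst z)) (snd z)))
      \<in> borel_measurable (lborel \<Otimes>\<^sub>M sample Z)" for n
  proof -
    have "(\<lambda>z. the (path Z (max 0 ((real_of_int \<lfloor>real (Suc n) * fst z\<rfloor> + 1) / real (Suc n))) (snd z)))
        \<in> borel_measurable (lborel \<Otimes>\<^sub>M sample Z)"
    proof (rule measurable_compose_countable[where
          f = "\<lambda>i z. the (path Z (max 0 ((real_of_int i + 1) / real (Suc n))) (snd z))"])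
      fix i :: int
      show "(\<lambda>z. the (path Z (max 0 ((real_of_int i + 1) / real (Suc n))) (snd z)))
          \<in> borel_measurable (lborel \<Otimes>\<^sub>M sample Z)"
        by (rule measurable_compose[OF measurable_snd measurable_position[OF hunt]]) simp
    qed measurable
    then show ?thesis unfolding \<sigma>_def by measurable
  qed
  have "(\<lambda>z. indicat_real (before_exit Z U) z *\<^sub>R the (path Z (fst z) (snd z)))
      \<in> borel_measurable (lborel \<Otimes>\<^sub>M sample Z)"
  proof (rule borel_measurable_LIMSEQ_metric[OF meas])
    fix z
    show "(\<lambda>n. indicat_real (before_exit Z U) z *\<^sub>R the (path Z (\<sigma> n (fst z)) (snd z)))
        \<longlonglongrightarrow> indicat_real (before_exit Z U) z *\<^sub>R the (path Z (fst z) (snd z))"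
    proof (cases "z \<in> before_exit Z U")
      case True
      then obtain t \<omega> where z: "z = (t, \<omega>)" "0 < t" "\<omega> \<in> space (sample Z)"
          "ereal t < exit_time U (path Z) \<omega>"
        by (auto simp: before_exit_def)
      have "path Z t \<omega> \<in> Some ` U"
        using less_exit_time_iff[OF hunt z(3) U z(2)] z by auto
      then have life: "ereal t < lifetime (path Z) \<omega>"
        using z by (intro less_lifetime[OF hunt z(3) V]) auto
      have "(\<lambda>n. \<sigma> n t) \<longlonglongrightarrow> t"
      proof (rule LIM_zero_cancel)
        have bd: "\<bar>\<sigma> n t - t\<bar> \<le> 1 / real (Suc n)" for n
        proof -
          let ?k = "real (Suc n)"
          have "real_of_int \<lfloor>?k * t\<rfloor> \<le> ?k * t" "?k * t < real_of_int \<lfloor>?k * t\<rfloor> + 1"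
            by linarith+
          then have "?k * t / ?k \<le> (real_of_int \<lfloor>?k * t\<rfloor> + 1) / ?k"
              "(real_of_int \<lfloor>?k * t\<rfloor> + 1) / ?k \<le> (?k * t + 1) / ?k"
            by (intro divide_right_mono; linarith)+
          moreover have "?k * t / ?k = t" "(?k * t + 1) / ?k = t + 1 / ?k"
            by (simp_all add: add_divide_distrib)
          ultimately have "t \<le> (real_of_int \<lfloor>?k * t\<rfloor> + 1) / ?k" "(real_of_int \<lfloor>?k * t\<rfloor> + 1) / ?k \<le> t + 1 / ?k"
            by linarith+
          then show ?thesis using z(2) unfolding \<sigma>_def by auto
        qed
        show "(\<lambda>n. \<sigma> n t - t) \<longlonglongrightarrow> 0"
          using bd by (intro Lim_null_comparison[OF _ LIMSEQ_Suc[OF lim_1_over_n]]) auto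
      qed
      moreover have "\<forall>\<^sub>F n in sequentially. \<sigma> n t \<in> {s. 0 \<le> s \<and> ereal s < lifetime (path Z) \<omega>}"
      proof -
        have "\<forall>\<^sub>F n in sequentially. ereal (\<sigma> n t) < lifetime (path Z) \<omega>"
          using calculation by (intro order_tendstoD(2)[OF _ life]) simp
        then show ?thesis by eventually_elim (simp add: \<sigma>_def)
      qed
      ultimately have "(\<lambda>n. the (path Z (\<sigma> n t) \<omega>)) \<longlonglongrightarrow> the (path Z t \<omega>)"
        using cont z life unfolding continuous_process_def
        by (intro continuous_on_tendsto_compose[where f = "\<lambda>t. the (path Z t \<omega>)"]) auto
      then show ?thesis by (simp add: z tendsto_intros)
    qed simp
  qed
  then show ?thesis by (simp add: case_prod_unfold)
qed

text \<open>The law of the killed process at time \<open>t\<close>, as a measure on the Euclidean space. It has total mass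
  at most \<open>1\<close>, as the part of the law at the cemetery is removed by the indicator function.\<close>

lemma distr_killed_process:
  assumes hunt: "hunt_process V Z" and cont: "continuous_process Z" and V: "open V"
    and U: "open U" "U \<subseteq> V" and x: "x \<in> U" and t: "0 < t"
    and dens: "has_transition_density U (law Z) (killed U (path Z)) q"
  shows "distr (density (law Z (Some x)) (\<lambda>\<omega>. indicator (before_exit Z U) (t, \<omega>))) borel
      (\<lambda>\<omega>. the (path Z t \<omega>)) = density lborel (\<lambda>y. ennreal (indicat_real U y * q t x y))"
proof (rule measure_eqI)
  let ?P = "law Z (Some x)" let ?E = "{\<omega>\<in>space (sample Z). ereal t < exit_time U (path Z) \<omega>}"
  note P = hunt_law[OF hunt, of "Some x"]
  have [measurable]: "U \<in> sets borel" using U by simp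
  have E: "?E \<in> sets ?P" using measurable_less_exit_time[OF hunt cont V U t] P by simp
  have pos [measurable]: "(\<lambda>\<omega>. the (path Z t \<omega>)) \<in> borel_measurable ?P"
    using measurable_position[OF hunt, of t] t P by (simp cong: measurable_cong_sets)
  have ind: "indicator (before_exit Z U) (t, \<omega>) = indicator ?E \<omega>" for \<omega>
    using t by (simp add: before_exit_def indicator_def)
  have q [measurable]: "(\<lambda>y. indicat_real U y * q t x y) \<in> borel_measurable borel"
  proof -
    have "q t x \<in> borel_measurable (restrict_space borel U)"
      using dens t x unfolding has_transition_density_def by blast
    then show ?thesis by (subst (asm) borel_measurable_restrict_space_iff) auto
  qed
  fix B :: "'a set"
  assume "B \<in> sets (distr (density ?P (\<lambda>\<omega>. indicator (before_exit Z U) (t, \<omega>))) borel (\<lambda>\<omega>. the (path Z t \<omega>)))"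
  then have B [measurable]: "B \<in> sets borel" by simp
  have pre: "(\<lambda>\<omega>. the (path Z t \<omega>)) -` B \<inter> space ?P \<in> sets ?P"
    by measurable
  have "emeasure (distr (density ?P (\<lambda>\<omega>. indicator (before_exit Z U) (t, \<omega>))) borel (\<lambda>\<omega>. the (path Z t \<omega>))) B
      = emeasure (density ?P (indicator ?E)) ((\<lambda>\<omega>. the (path Z t \<omega>)) -` B \<inter> space ?P)"
    unfolding ind by (subst emeasure_distr) (auto simp: pos)
  also have "\<dots> = emeasure ?P (?E \<inter> ((\<lambda>\<omega>. the (path Z t \<omega>)) -` B \<inter> space ?P))"
    using E pre by (subst emeasure_density) (auto simp: indicator_inter_arith[symmetric] simp del: vimage_Int)
  also have "?E \<inter> ((\<lambda>\<omega>. the (path Z t \<omega>)) -` B \<inter> space ?P) =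
      {\<omega>\<in>space ?P. killed U (path Z) t \<omega> \<in> Some ` (B \<inter> U)}"
    using killed_eq[OF hunt _ U t] P by (auto split: if_splits)
  also have "emeasure ?P \<dots> = (\<integral>\<^sup>+y\<in>B \<inter> U. ennreal (q t x y) \<partial>lborel)"
    using dens t x unfolding has_transition_density_def by auto
  also have "\<dots> = emeasure (density lborel (\<lambda>y. ennreal (indicat_real U y * q t x y))) B"
  proof (subst emeasure_density)
    show "(\<lambda>y. ennreal (indicat_real U y * q t x y)) \<in> borel_measurable lborel"
      using measurable_compose[OF q measurable_ennreal] by simp
  qed (auto intro!: nn_integral_cong simp: indicator_def)
  finally show "emeasure (distr (density ?P (\<lambda>\<omega>. indicator (before_exit Z U) (t, \<omega>))) borel (\<lambda>\<omega>. the (path Z t \<omega>))) B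
      = emeasure (density lborel (\<lambda>y. ennreal (indicat_real U y * q t x y))) B" .
qed simp

section \<open>The resolvent as a space-time integral\<close>

lemma nn_integral_killed_process:
  assumes hunt: "hunt_process V Z" and cont: "continuous_process Z" and V: "open V"
    and U: "open U" "U \<subseteq> V" and x: "x \<in> U" and t: "0 < t"
    and dens: "has_transition_density U (law Z) (killed U (path Z)) q"
    and h: "h \<in> borel_measurable borel"
  shows "(\<integral>\<^sup>+\<omega>. indicator (before_exit Z U) (t, \<omega>) * h (the (path Z t \<omega>)) \<partial>law Z (Some x)) =
    (\<integral>\<^sup>+y. ennreal (indicat_real U y * q t x y) * h y \<partial>lborel)"
    and "(\<lambda>\<omega>. indicat_real (before_exit Z U) (t, \<omega>)) \<in> borel_measurable (law Z (Some x))"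
    and "(\<lambda>\<omega>. the (path Z t \<omega>)) \<in> borel_measurable (law Z (Some x))"
    and "(\<lambda>y. indicat_real U y * q t x y) \<in> borel_measurable lborel"
proof -
  note P = hunt_law[OF hunt, of "Some x"]
  show pos [measurable]: "(\<lambda>\<omega>. the (path Z t \<omega>)) \<in> borel_measurable (law Z (Some x))"
    using measurable_position[OF hunt, of t] t P by (simp cong: measurable_cong_sets)
  have "(\<lambda>\<omega>. indicat_real {\<omega>\<in>space (sample Z). ereal t < exit_time U (path Z) \<omega>} \<omega>)
      \<in> borel_measurable (law Z (Some x))"
    using measurable_less_exit_time[OF hunt cont V U t] P by simp
  moreover have "indicat_real {\<omega>\<in>space (sample Z). ereal t < exit_time U (path Z) \<omega>} \<omega> =
      indicat_real (before_exit Z U) (t, \<omega>)" for \<omega>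
    using t by (simp add: before_exit_def indicator_def)
  ultimately show ind [measurable]:
    "(\<lambda>\<omega>. indicat_real (before_exit Z U) (t, \<omega>)) \<in> borel_measurable (law Z (Some x))"
    by simp
  have "q t x \<in> borel_measurable (restrict_space borel U)"
    using dens t x unfolding has_transition_density_def by blast
  then show q [measurable]: "(\<lambda>y. indicat_real U y * q t x y) \<in> borel_measurable lborel"
    using U(1) by (subst (asm) borel_measurable_restrict_space_iff) auto
  have ind': "(\<lambda>\<omega>. indicator (before_exit Z U) (t, \<omega>) :: ennreal) \<in> borel_measurable (law Z (Some x))"
    using measurable_compose[OF ind measurable_ennreal] by (simp add: ennreal_indicator)
  have "(\<integral>\<^sup>+\<omega>. indicator (before_exit Z U) (t, \<omega>) * h (the (path Z t \<omega>)) \<partial>law Z (Some x)) =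
      (\<integral>\<^sup>+y. h y \<partial>distr (density (law Z (Some x)) (\<lambda>\<omega>. indicator (before_exit Z U) (t, \<omega>))) borel
        (\<lambda>\<omega>. the (path Z t \<omega>)))"
    using h ind' by (simp add: nn_integral_distr nn_integral_density measurable_compose[OF pos h])
  also have "\<dots> = (\<integral>\<^sup>+y. ennreal (indicat_real U y * q t x y) * h y \<partial>lborel)"
    unfolding distr_killed_process[OF hunt cont V U x t dens]
    using h q by (subst nn_integral_density) auto
  finally show "(\<integral>\<^sup>+\<omega>. indicator (before_exit Z U) (t, \<omega>) * h (the (path Z t \<omega>)) \<partial>law Z (Some x)) =
    (\<integral>\<^sup>+y. ennreal (indicat_real U y * q t x y) * h y \<partial>lborel)" .
qed

lemma integral_killed_process:
  fixes h :: "'a::euclidean_space \<Rightarrow> real"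
  assumes hunt: "hunt_process V Z" and cont: "continuous_process Z" and V: "open V"
    and U: "open U" "U \<subseteq> V" and x: "x \<in> U" and t: "0 < t"
    and dens: "has_transition_density U (law Z) (killed U (path Z)) q"
    and h: "h \<in> borel_measurable borel"
  shows "(\<integral>\<omega>. indicat_real (before_exit Z U) (t, \<omega>) * h (the (path Z t \<omega>)) \<partial>law Z (Some x)) =
    (\<integral>y. indicat_real U y * q t x y * h y \<partial>lborel)"
proof -
  note meas = nn_integral_killed_process(2-4)[OF hunt cont V U x t dens borel_measurable_const]
  have q_nn: "0 \<le> indicat_real U y * q t x y" for y
    using dens t x unfolding has_transition_density_def by (auto simp: indicator_def)
  have "(\<integral>\<omega>. indicat_real (before_exit Z U) (t, \<omega>) * h (the (path Z t \<omega>)) \<partial>law Z (Some x)) =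
      (\<integral>y. h y \<partial>distr (density (law Z (Some x)) (\<lambda>\<omega>. ennreal (indicat_real (before_exit Z U) (t, \<omega>)))) borel
        (\<lambda>\<omega>. the (path Z t \<omega>)))"
    using h meas
    by (subst integral_distr) (simp_all add: integral_real_density measurable_compose[OF meas(2) h])
  also have "\<dots> = (\<integral>y. indicat_real U y * q t x y * h y \<partial>lborel)"
    using distr_killed_process[OF hunt cont V U x t dens] h meas q_nn
    by (simp add: ennreal_indicator integral_real_density)
  finally show ?thesis .
qed

lemma resolvent_killed_eq_space_time_integral:
  assumes hunt: "hunt_process V Z" and cont: "continuous_process Z" and V: "open V"
    and U: "open U" "U \<subseteq> V" and x: "x \<in> U"
    and dens: "has_transition_density U (law Z) (killed U (path Z)) q"
    and int: "integrable (lborel \<Otimes>\<^sub>M lborel) (\<lambda>z. indicat_real ({0<..} \<times> U) z * q (fst z) x (snd z))"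
    and f: "f \<in> borel_measurable (restrict_space borel U)" "\<And>y. y \<in> U \<Longrightarrow> \<bar>f y\<bar> \<le> C" and \<alpha>: "0 \<le> \<alpha>"
  shows "resolvent (law Z) (killed U (path Z)) \<alpha> f x =
    (\<integral>z. indicat_real ({0<..} \<times> U) z * (exp (- \<alpha> * fst z) * f (snd z)) *
        (indicat_real ({0<..} \<times> U) z * q (fst z) x (snd z)) \<partial>(lborel \<Otimes>\<^sub>M lborel))"
proof -
  let ?P = "law Z (Some x)"
  define S where "S = before_exit Z U"
  define F where "F y = indicat_real U y * f y" for y
  define K where "K z = indicat_real ({0<..} \<times> U) z * q (fst z) x (snd z)" for z
  define g where "g z = indicat_real ({0<..} \<times> U) z * (exp (- \<alpha> * fst z) * f (snd z))" for z
  define \<Phi> where "\<Phi> t \<omega> = indicat_real S (t, \<omega>) * (exp (- \<alpha> * t) * F (the (path Z t \<omega>)))" for t \<omega>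
  note P = hunt_law[OF hunt, of "Some x"]
  interpret P: prob_space ?P by (rule P)
  interpret LP: pair_sigma_finite lborel ?P ..
  have U_sets [measurable]: "U \<in> sets borel" using U by simp
  have F [measurable]: "F \<in> borel_measurable borel"
    using f(1) by (subst (asm) borel_measurable_restrict_space_iff) (auto simp: F_def[abs_def])
  have S_sets [measurable]: "S \<in> sets (lborel \<Otimes>\<^sub>M ?P)"
    using sets_before_exit[OF hunt cont V U] P
    by (simp add: S_def cong: sets_pair_measure_cong)
  have "(\<lambda>(t, \<omega>). indicat_real S (t, \<omega>) *\<^sub>R the (path Z t \<omega>)) \<in> borel_measurable (lborel \<Otimes>\<^sub>M ?P)"
    using measurable_position_before_exit[OF hunt cont V U] P
    by (simp add: S_def cong: measurable_cong_sets sets_pair_measure_cong)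
  then have "(\<lambda>z. indicat_real S z * (exp (- \<alpha> * fst z) *
      F (indicat_real S z *\<^sub>R the (path Z (fst z) (snd z))))) \<in> borel_measurable (lborel \<Otimes>\<^sub>M ?P)"
    unfolding case_prod_unfold prod.collapse by measurable
  moreover have "indicat_real S z * (exp (- \<alpha> * fst z) * F (indicat_real S z *\<^sub>R the (path Z (fst z) (snd z)))) =
      \<Phi> (fst z) (snd z)" for z
    by (simp add: \<Phi>_def indicator_def)
  ultimately have \<Phi> [measurable]: "case_prod \<Phi> \<in> borel_measurable (lborel \<Otimes>\<^sub>M ?P)"
    by (simp add: case_prod_unfold)
  have K [measurable]: "K \<in> borel_measurable (lborel \<Otimes>\<^sub>M lborel)"
    using int by (auto simp: K_def[abs_def])
  have K_nn: "0 \<le> K z" for z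
    using dens x unfolding K_def has_transition_density_def by (auto simp: indicator_def)
  have g_eq: "g z = indicat_real {0<..} (fst z) * (exp (- \<alpha> * fst z) * F (snd z))" for z
    by (cases z) (simp add: g_def F_def indicator_def)
  have g [measurable]: "g \<in> borel_measurable (lborel \<Otimes>\<^sub>M lborel)"
    unfolding g_eq[abs_def] by measurable
  have g_le: "\<bar>g z\<bar> \<le> \<bar>C\<bar>" for z
  proof (cases "z \<in> {0<..} \<times> U")
    case True
    then have "exp (- \<alpha> * fst z) \<le> 1" "\<bar>f (snd z)\<bar> \<le> \<bar>C\<bar>"
      using \<alpha> f(2)[of "snd z"] by auto
    then have "exp (- \<alpha> * fst z) * \<bar>f (snd z)\<bar> \<le> 1 * \<bar>C\<bar>"
      by (intro mult_mono) auto
    then show ?thesis using True by (simp add: g_def abs_mult)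
  qed (simp add: g_def)
  have gK: "integrable (lborel \<Otimes>\<^sub>M lborel) (\<lambda>z. g z * K z)"
  proof (rule Bochner_Integration.integrable_bound)
    show "integrable (lborel \<Otimes>\<^sub>M lborel) (\<lambda>z. \<bar>C\<bar> * K z)"
      using int by (simp add: K_def)
    show "AE z in lborel \<Otimes>\<^sub>M lborel. norm (g z * K z) \<le> norm (\<bar>C\<bar> * K z)"
      using g_le K_nn by (auto simp: abs_mult intro!: mult_right_mono)
  qed measurable
  have slice_nn: "(\<integral>\<^sup>+\<omega>. ennreal (norm (\<Phi> t \<omega>)) \<partial>?P) = (\<integral>\<^sup>+y. ennreal (norm (g (t, y) * K (t, y))) \<partial>lborel)" for t
  proof (cases "0 < t")
    case True
    have "(\<integral>\<^sup>+\<omega>. ennreal (norm (\<Phi> t \<omega>)) \<partial>?P) =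
        (\<integral>\<^sup>+\<omega>. indicator S (t, \<omega>) * ennreal (exp (- \<alpha> * t) * \<bar>F (the (path Z t \<omega>))\<bar>) \<partial>?P)"
      by (intro nn_integral_cong) (auto simp: \<Phi>_def abs_mult indicator_def)
    also have "\<dots> = (\<integral>\<^sup>+y. ennreal (indicat_real U y * q t x y) * ennreal (exp (- \<alpha> * t) * \<bar>F y\<bar>) \<partial>lborel)"
      unfolding S_def by (rule nn_integral_killed_process[OF hunt cont V U x True dens]) measurable
    also have "\<dots> = (\<integral>\<^sup>+y. ennreal (norm (g (t, y) * K (t, y))) \<partial>lborel)"
    proof (rule nn_integral_cong)
      fix y
      have "0 \<le> q t x y" if "y \<in> U"
        using K_nn[of "(t, y)"] True that by (simp add: K_def)
      then show "ennreal (indicat_real U y * q t x y) * ennreal (exp (- \<alpha> * t) * \<bar>F y\<bar>) =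
          ennreal (norm (g (t, y) * K (t, y)))"
        using True by (cases "y \<in> U")
          (simp_all add: g_def K_def F_def abs_mult ennreal_mult[symmetric] mult.commute)
    qed
    finally show ?thesis .
  qed (simp add: \<Phi>_def S_def before_exit_def g_def)
  have slice: "(\<integral>\<omega>. \<Phi> t \<omega> \<partial>?P) = (\<integral>y. g (t, y) * K (t, y) \<partial>lborel)" for t
  proof (cases "0 < t")
    case True
    have "(\<integral>\<omega>. \<Phi> t \<omega> \<partial>?P) = (\<integral>y. indicat_real U y * q t x y * (exp (- \<alpha> * t) * F y) \<partial>lborel)"
      unfolding \<Phi>_def S_def by (rule integral_killed_process[OF hunt cont V U x True dens]) measurable
    also have "\<dots> = (\<integral>y. g (t, y) * K (t, y) \<partial>lborel)"
      using True by (intro Bochner_Integration.integral_cong) (auto simp: g_def K_def F_def indicator_def)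
    finally show ?thesis .
  qed (simp add: \<Phi>_def S_def before_exit_def g_def)
  have int_\<Phi>: "integrable (lborel \<Otimes>\<^sub>M ?P) (case_prod \<Phi>)"
  proof (rule integrableI_bounded)
    have "(\<integral>\<^sup>+z. ennreal (norm (case_prod \<Phi> z)) \<partial>(lborel \<Otimes>\<^sub>M ?P)) =
        (\<integral>\<^sup>+t. (\<integral>\<^sup>+\<omega>. ennreal (norm (\<Phi> t \<omega>)) \<partial>?P) \<partial>lborel)"
      by (subst P.nn_integral_fst[symmetric]) auto
    also have "\<dots> = (\<integral>\<^sup>+z. ennreal (norm (g z * K z)) \<partial>(lborel \<Otimes>\<^sub>M lborel))"
      unfolding slice_nn by (subst lborel.nn_integral_fst) auto
    also have "\<dots> < \<infinity>"
      using gK by (simp add: integrable_iff_bounded)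
    finally show "(\<integral>\<^sup>+z. ennreal (norm (case_prod \<Phi> z)) \<partial>(lborel \<Otimes>\<^sub>M ?P)) < \<infinity>" .
  qed (rule \<Phi>)
  \<comment> \<open>The two integrands can differ at time \<open>0\<close> only, which is a null set.\<close>
  have inner: "(LINT t:{0..}|lborel. exp (- \<alpha> * t) * ext0 f (killed U (path Z) t \<omega>)) = (\<integral>t. \<Phi> t \<omega> \<partial>lborel)"
    if \<omega>: "\<omega> \<in> space ?P" for \<omega>
    unfolding set_lebesgue_integral_def
  proof (rule integral_discrete_difference[where X = "{0}"])
    fix t :: real assume "t \<notin> {0}"
    then consider "t < 0" | "0 < t" by fastforce
    then show "indicat_real {0..} t *\<^sub>R (exp (- \<alpha> * t) * ext0 f (killed U (path Z) t \<omega>)) = \<Phi> t \<omega>"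
    proof cases
      case 1
      then show ?thesis by (simp add: \<Phi>_def S_def before_exit_def)
    next
      case 2
      then show ?thesis
        using killed_eq[OF hunt _ U 2, of \<omega>] \<omega> P
        by (auto simp: \<Phi>_def S_def before_exit_def F_def ext0_def)
    qed
  qed auto
  have "resolvent (law Z) (killed U (path Z)) \<alpha> f x = (\<integral>\<omega>. (\<integral>t. \<Phi> t \<omega> \<partial>lborel) \<partial>?P)"
    unfolding resolvent_def by (intro Bochner_Integration.integral_cong inner) auto
  also have "\<dots> = (\<integral>t. (\<integral>\<omega>. \<Phi> t \<omega> \<partial>?P) \<partial>lborel)"
    by (rule LP.Fubini_integral[OF int_\<Phi>])
  also have "\<dots> = (\<integral>z. g z * K z \<partial>(lborel \<Otimes>\<^sub>M lborel))"
    unfolding slice using gK by (rule lborel_pair.integral_fst')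
  finally show ?thesis by (simp add: g_def K_def)
qed

section \<open>Comparison of transition densities\<close>

text \<open>As \<open>P\<close> is the density of the process killed on exiting its whole state space \<open>V\<close>, it is the density
  of the process itself. If the inequality failed, it would fail on a nonempty open set \<open>B\<close>, and the killed
  process would visit \<open>B\<close> at time \<open>t\<close> with the greater probability.\<close>

lemma transition_density_mono:
  assumes hunt: "hunt_process V Z" and V: "open V" and U: "open U" "U \<subseteq> V"
    and p: "has_continuous_transition_density U (law Z) (killed U (path Z)) p"
    and P: "has_continuous_transition_density V (law Z) (killed V (path Z)) P"
    and t: "0 < t" and x: "x \<in> U" and y: "y \<in> U"
  shows "p t x y \<le> P t x y"
proof (rule ccontr)
  assume not_le: "\<not> p t x y \<le> P t x y"
  let ?L = "law Z (Some x)"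
  interpret prob_space ?L by (rule hunt_law[OF hunt])
  have xV: "x \<in> V" using x U by auto
  have contin: "continuous_on W (k t x)"
    if "x \<in> W" "continuous_on ({0<..} \<times> W \<times> W) (\<lambda>(t, x, y). k t x y)" for W k
  proof -
    have "continuous_on W ((\<lambda>(t, x, y). k t x y) \<circ> (\<lambda>y. (t, x, y)))"
      by (intro continuous_on_compose continuous_on_subset[OF that(2)] continuous_intros)
         (use t that(1) in auto)
    then show ?thesis by (simp add: o_def)
  qed
  have cp: "continuous_on U (p t x)" and cP: "continuous_on U (P t x)"
    using contin[OF x, of p] contin[OF xV, of P] p P U
    by (auto simp: has_continuous_transition_density_def intro: continuous_on_subset)
  define B where "B = U \<inter> (\<lambda>y. p t x y - P t x y) -` {0<..}"
  have B: "open B" "B \<subseteq> U" "y \<in> B"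
    using continuous_on_open_vimage[OF U(1), of "\<lambda>y. p t x y - P t x y"] cp cP not_le y
    by (auto simp: B_def Int_commute intro!: continuous_open_preimage continuous_intros U)
  have [measurable]: "B \<in> sets borel" using B by simp
  have dens: "emeasure ?L {\<omega>\<in>space ?L. killed W (path Z) t \<omega> \<in> Some ` B} = (\<integral>\<^sup>+y\<in>B. ennreal (k t x y) \<partial>lborel)"
    if "has_continuous_transition_density W (law Z) (killed W (path Z)) k" "x \<in> W" "B \<subseteq> W" for W k
    using that t by (auto simp: has_continuous_transition_density_def has_transition_density_def)
  \<comment> \<open>The event on the right is measurable, being one of the process itself. The event on the left
    need not be known to be measurable for the comparison of the measures.\<close>
  have subset: "{\<omega>\<in>space ?L. killed U (path Z) t \<omega> \<in> Some ` B} \<subseteq> {\<omega>\<in>space ?L. killed V (path Z) t \<omega> \<in> Some ` B}"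
    using killed_whole_space[OF hunt _ V t] hunt_law(2)[OF hunt, of "Some x"]
    by (auto simp: killed_def[of U] split: if_splits)
  have V_eq: "{\<omega>\<in>space ?L. killed V (path Z) t \<omega> \<in> Some ` B} = {\<omega>\<in>space (sample Z). path Z t \<omega> \<in> Some ` B}"
    using killed_whole_space[OF hunt _ V t] hunt_law(2)[OF hunt, of "Some x"] by auto
  have le: "(\<integral>\<^sup>+y\<in>B. ennreal (p t x y) \<partial>lborel) \<le> (\<integral>\<^sup>+y\<in>B. ennreal (P t x y) \<partial>lborel)"
  proof -
    have BV: "B \<subseteq> V" using B U by auto
    have "{\<omega>\<in>space ?L. killed V (path Z) t \<omega> \<in> Some ` B} \<in> sets ?L"
      unfolding V_eq using hunt_measurable_event[OF hunt, of t B] hunt_law(3)[OF hunt] t by simp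
    from emeasure_mono[OF subset this] show ?thesis
      unfolding dens[OF p x B(2)] dens[OF P xV BV] .
  qed
  have fin: "(\<integral>\<^sup>+y\<in>B. ennreal (P t x y) \<partial>lborel) \<noteq> \<infinity>"
  proof -
    have "B \<subseteq> V" using B U by auto
    from dens[OF P xV this] show ?thesis by (metis emeasure_finite infinity_ennreal_def)
  qed
  have meas: "(\<lambda>y. indicat_real B y * p t x y) \<in> borel_measurable lborel"
      "(\<lambda>y. indicat_real B y * P t x y) \<in> borel_measurable lborel"
    using borel_measurable_continuous_on_indicator[of B "p t x"]
      borel_measurable_continuous_on_indicator[of B "P t x"] cp cP B(2)
    by (auto intro: continuous_on_subset)
  have P_nn: "0 \<le> P t x y" if "y \<in> U" for y
    using P xV that U t by (auto simp: has_continuous_transition_density_def has_transition_density_def)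
  have ind: "(\<integral>\<^sup>+y\<in>B. ennreal (k y) \<partial>lborel) = (\<integral>\<^sup>+y. ennreal (indicat_real B y * k y) \<partial>lborel)" for k
    by (intro nn_integral_cong) (simp add: indicator_def)
  have P_le_p: "indicat_real B y * P t x y \<le> indicat_real B y * p t x y" for y
    by (simp add: B_def indicator_def)
  have "AE y in lborel. ennreal (indicat_real B y * P t x y) = ennreal (indicat_real B y * p t x y)"
  proof (rule ccontr)
    assume "\<not> (AE y in lborel. ennreal (indicat_real B y * P t x y) = ennreal (indicat_real B y * p t x y))"
    then have "\<not> (AE y in lborel. ennreal (indicat_real B y * p t x y) \<le> ennreal (indicat_real B y * P t x y))"
      using ennreal_leI[OF P_le_p]
      by (elim contrapos_nn eventually_mono) (rule antisym)
    then have "(\<integral>\<^sup>+y\<in>B. ennreal (P t x y) \<partial>lborel) < (\<integral>\<^sup>+y\<in>B. ennreal (p t x y) \<partial>lborel)"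
      unfolding ind
      by (intro nn_integral_less measurable_compose[OF meas(1) measurable_ennreal]
            measurable_compose[OF meas(2) measurable_ennreal] fin[unfolded ind]
            always_eventually allI ennreal_leI[OF P_le_p])
    with le show False by simp
  qed
  then have "AE y in lborel. y \<notin> B"
  proof eventually_elim
    case (elim y)
    then show ?case using P_nn[of y] by (auto simp: B_def ennreal_inj split: if_splits)
  qed
  then have "emeasure lborel B = 0"
    using AE_iff_measurable[of B lborel "\<lambda>y. y \<notin> B"] by simp
  then have "negligible B"
    by (simp add: negligible_iff_null_sets null_sets_def)
  with B show False using open_not_negligible[of B] by auto
qed

section \<open>The strong Feller property of the dual resolvent\<close>

theorem proposition2p5:
  fixes \<mu> :: "'d::finite \<Rightarrow> (real^'d) signed_measure"
    and \<nu> :: "(real^'d) measure"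
    and L :: operator_form
    and A :: "real^'d \<Rightarrow> real^'d^'d"
    and \<phi> :: "real^'d \<Rightarrow> real"
    and X :: "('w, real^'d) process"
    and V U :: "(real^'d) set"
    and q :: "real \<Rightarrow> real^'d \<Rightarrow> real^'d \<Rightarrow> real"
    and AV :: "real \<Rightarrow> 'w \<Rightarrow> real"
    and Y :: "('v, real^'d) process"
    and r :: "(real^'d) set \<Rightarrow> real \<Rightarrow> real^'d \<Rightarrow> real^'d \<Rightarrow> real"
    and H :: "real^'d \<Rightarrow> real"
    and Yhat :: "('u, real^'d) process"
  assumes dim: "CARD('d) \<ge> 3"
    and mu: "\<And>i. kato_class 1 (\<mu> i)"
    and nu: "kato_class 2 (nonneg_signed \<nu>)"
    and A: "symmetric_coefficients A" "Ck_on 1 A UNIV" "uniformly_elliptic A"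
    and phi: "mollifier \<phi>"
    and X: "singular_drift_diffusion L A \<phi> \<mu> X"
    and V: "bounded V" "smooth_domain V"
    and q: "has_continuous_transition_density V (law X) (killed V (path X)) q"
    and AV: "killed_pcaf V X AV" "pcaf_of_measure V X q \<nu> AV"
    and Y: "killed_by_functional V X AV Y"
    and r: "\<And>D. open D \<Longrightarrow> D \<subseteq> V \<Longrightarrow>
              has_continuous_transition_density D (law Y) (killed D (path Y)) (r D)"
    and H_def: "H = ref_weight V (r V)"
    and H: "\<And>x. x \<in> V \<Longrightarrow> 0 < H x" "bounded (H ` V)" "continuous_on V H"
    and Yhat: "dual_process V (r V) Y Yhat"
    and rhat: "\<And>D. is_domain D \<Longrightarrow> D \<subseteq> V \<Longrightarrow>
              has_transition_density D (law Yhat) (killed D (path Yhat)) (dual_density H (r D))"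
    and U: "is_domain U" "U \<subseteq> V"
  shows "strong_feller_resolvent U (law Yhat) (killed U (path Yhat))"
proof -
  have openV: "open V" using V(2) by (simp add: smooth_domain_def is_domain_def)
  have openU: "open U" using U(1) by (simp add: is_domain_def)
  have huntY: "hunt_process V Y" using Y by (simp add: killed_by_functional_def)
  have Yhat': "hunt_process V Yhat" "continuous_process Yhat"
    using Yhat by (simp_all add: dual_process_def)
  note densV = r[OF openV subset_refl] and densU = r[OF openU U(2)]
  have contV: "continuous_on ({0<..} \<times> V \<times> V) (\<lambda>(t, y, x). r V t y x)"
    and contU: "continuous_on ({0<..} \<times> U \<times> U) (\<lambda>(t, y, x). r U t y x)"
    using densV densU by (simp_all add: has_continuous_transition_density_def)
  have rV: "0 \<le> r V t y x" if "0 < t" "y \<in> V" "x \<in> V" for t y x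
    using densV that by (simp add: has_continuous_transition_density_def has_transition_density_def)
  have rU: "0 \<le> r U t y x \<and> r U t y x \<le> r V t y x" if "0 < t" "y \<in> U" "x \<in> U" for t y x
    using densU that transition_density_mono[OF huntY openV openU U(2) densU densV that]
    by (simp add: has_continuous_transition_density_def has_transition_density_def)
  \<comment> \<open>The conversion \<open>enn2real\<close> in \<open>H\<close> loses nothing: it would send \<open>\<infinity>\<close> to \<open>0\<close>, but \<open>H > 0\<close> on \<open>V\<close>.\<close>
  have H_eq: "(\<integral>\<^sup>+y\<in>V. green (r V) y x \<partial>lborel) = ennreal (H x)" if "x \<in> V" for x
  proof -
    have "H x = enn2real (\<integral>\<^sup>+y\<in>V. green (r V) y x \<partial>lborel)"
      by (simp only: H_def ref_weight_def)
    moreover from this H(1)[OF that] have "(\<integral>\<^sup>+y\<in>V. green (r V) y x \<partial>lborel) \<noteq> top"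
      by (metis enn2real_top less_irrefl)
    ultimately show ?thesis by (simp only: ennreal_enn2real_if if_False)
  qed
  obtain B where B: "\<And>y. y \<in> V \<Longrightarrow> H y \<le> B"
    using H(2) by (auto simp: bounded_real abs_le_iff)
  show ?thesis
    unfolding strong_feller_resolvent_def
  proof (intro allI impI)
    fix f :: "real^'d \<Rightarrow> real" and \<alpha> :: real
    assume f: "f \<in> borel_measurable (restrict_space borel U)" "bounded (f ` U)" and \<alpha>: "0 \<le> \<alpha>"
    obtain C where C: "\<And>y. y \<in> U \<Longrightarrow> \<bar>f y\<bar> \<le> C"
      using f(2) by (auto simp: bounded_real)
    let ?M = "(lborel \<Otimes>\<^sub>M lborel) :: (real \<times> (real^'d)) measure"
    define g where "g z = indicat_real ({0<..} \<times> U) z * (exp (- \<alpha> * fst z) * f (snd z) * H (snd z))" for z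
    obtain y0 where "y0 \<in> U" "y0 \<in> V" using U by (auto simp: is_domain_def)
    with C[of y0] H(1)[of y0] B[of y0] have C0: "0 \<le> C" and B0: "0 \<le> B" by linarith+
    have g_meas: "g \<in> borel_measurable ?M"
    proof -
      have [measurable]: "U \<in> sets borel" using openU by simp
      have [measurable]: "(\<lambda>y. indicat_real U y * f y) \<in> borel_measurable borel"
        using f(1) by (subst (asm) borel_measurable_restrict_space_iff) auto
      have [measurable]: "(\<lambda>y. indicat_real U y * H y) \<in> borel_measurable borel"
        using borel_measurable_continuous_on_indicator[of U H] continuous_on_subset[OF H(3) U(2)] by simp
      have "g = (\<lambda>z. indicat_real {0<..} (fst z) * exp (- \<alpha> * fst z) *
          (indicat_real U (snd z) * f (snd z)) * (indicat_real U (snd z) * H (snd z)))"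
        by (rule ext) (simp add: g_def indicator_def mem_Times_iff)
      then show ?thesis by simp
    qed
    have g_le: "\<bar>g z\<bar> \<le> C * B" for z
    proof (cases "z \<in> {0<..} \<times> U")
      case True
      then have "snd z \<in> U" "snd z \<in> V" "exp (- \<alpha> * fst z) \<le> 1" using \<alpha> U by auto
      then have "exp (- \<alpha> * fst z) * \<bar>f (snd z)\<bar> * H (snd z) \<le> 1 * C * B"
        using B C H(1)[of "snd z"] C0 by (intro mult_mono) (auto intro: less_imp_le)
      then show ?thesis
        using True H(1)[of "snd z"] \<open>snd z \<in> V\<close> by (simp add: g_def abs_mult)
    qed (use B0 C0 in \<open>simp add: g_def\<close>)
    define I where "I x = (\<integral>z. g z * space_time_kernel U (r U) x z \<partial>?M)" for x
    have contI: "continuous_on U I"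
      unfolding I_def
    proof (rule continuous_on_space_time_integral[OF openU openV U(2) contU contV rU rV _ _ _ g_meas g_le])
      show "continuous_on U H" using H(3) U(2) by (rule continuous_on_subset)
      show "(\<integral>\<^sup>+y\<in>V. green (r V) y x \<partial>lborel) = ennreal (H x)" "0 \<le> H x" if "x \<in> U" for x
        using H_eq[OF subsetD[OF U(2) that]] H(1)[OF subsetD[OF U(2) that]] by simp_all
    qed
    have int: "integrable ?M (space_time_kernel V (r V) x)" "integral\<^sup>L ?M (space_time_kernel V (r V) x) = H x"
      if "x \<in> V" for x
      using space_time_kernel_integral[OF openV that contV rV[OF _ _ that] H_eq[OF that] less_imp_le[OF H(1)[OF that]]]
      by simp_all
    have ker: "0 \<le> space_time_kernel U (r U) x z" "space_time_kernel U (r U) x z \<le> space_time_kernel V (r V) x z"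
      if "x \<in> U" for x z
      using space_time_kernel_mono[of U V x "r U" "r V", OF U(2) that rU[OF _ _ that] rV[OF _ _ subsetD[OF U(2) that]], of z]
      by simp_all
    have intU: "integrable ?M (space_time_kernel U (r U) x)" if "x \<in> U" for x
    proof (rule Bochner_Integration.integrable_bound)
      show "integrable ?M (space_time_kernel V (r V) x)" using int(1)[OF subsetD[OF U(2) that]] .
      show "AE z in ?M. norm (space_time_kernel U (r U) x z) \<le> norm (space_time_kernel V (r V) x z)"
      proof (rule AE_I2)
        fix z show "norm (space_time_kernel U (r U) x z) \<le> norm (space_time_kernel V (r V) x z)"
          using ker[OF that, of z] by simp
      qed
    qed (rule measurable_space_time_kernel[OF openU that contU])
    \<comment> \<open>The factor \<open>H x\<close> in this bound cancels against the denominator of the resolvent.\<close>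
    have I_le: "\<bar>I x\<bar> \<le> C * B * H x" if "x \<in> U" for x
    proof -
      have "\<bar>I x\<bar> \<le> (\<integral>z. \<bar>g z * space_time_kernel U (r U) x z\<bar> \<partial>?M)"
        unfolding I_def by (rule integral_abs_bound)
      also have "\<dots> \<le> (\<integral>z. C * B * space_time_kernel V (r V) x z \<partial>?M)"
      proof (rule integral_mono')
        show "integrable ?M (\<lambda>z. C * B * space_time_kernel V (r V) x z)"
          using int(1)[OF subsetD[OF U(2) that]] by simp
        fix z
        have "\<bar>g z\<bar> * space_time_kernel U (r U) x z \<le> C * B * space_time_kernel V (r V) x z"
          using g_le[of z] ker[OF that, of z] B0 C0 by (intro mult_mono) simp_all
        then show "\<bar>g z * space_time_kernel U (r U) x z\<bar> \<le> C * B * space_time_kernel V (r V) x z"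
          using ker(1)[OF that, of z] by (simp add: abs_mult)
        have "0 \<le> space_time_kernel V (r V) x z" using ker[OF that, of z] by linarith
        then show "0 \<le> C * B * space_time_kernel V (r V) x z" using B0 C0 by simp
      qed
      also have "\<dots> = C * B * H x" using int(2)[OF subsetD[OF U(2) that]] by simp
      finally show ?thesis .
    qed
    have res: "resolvent (law Yhat) (killed U (path Yhat)) \<alpha> f x = I x / H x" if "x \<in> U" for x
    proof -
      have kern: "indicat_real ({0<..} \<times> U) z * dual_density H (r U) (fst z) x (snd z) =
          (indicat_real ({0<..} \<times> U) z * H (snd z)) * space_time_kernel U (r U) x z / H x" for z
        by (cases "z \<in> {0<..} \<times> U") (simp_all add: dual_density_def space_time_kernel_def)
      have "integrable ?M (\<lambda>z. (indicat_real ({0<..} \<times> U) z * H (snd z)) * space_time_kernel U (r U) x z)"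
      proof (rule Bochner_Integration.integrable_bound)
        show "integrable ?M (\<lambda>z. B * space_time_kernel U (r U) x z)" using intU[OF that] by simp
        have bd: "\<bar>indicat_real ({0<..} \<times> U) z * H (snd z)\<bar> \<le> B" for z
        proof (cases "z \<in> {0<..} \<times> U")
          case True
          then have "snd z \<in> V" using U by auto
          with True show ?thesis using B[of "snd z"] H(1)[of "snd z"] by simp
        qed (use B0 in simp)
        show "AE z in ?M. norm ((indicat_real ({0<..} \<times> U) z * H (snd z)) * space_time_kernel U (r U) x z)
            \<le> norm (B * space_time_kernel U (r U) x z)"
        proof (rule AE_I2)
          fix z
          show "norm ((indicat_real ({0<..} \<times> U) z * H (snd z)) * space_time_kernel U (r U) x z)
              \<le> norm (B * space_time_kernel U (r U) x z)"
            using mult_right_mono[OF bd[of z] ker(1)[OF that, of z]] ker(1)[OF that, of z] B0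
            by (simp add: abs_mult)
        qed
        have [measurable]: "U \<in> sets borel" using openU by simp
        have [measurable]: "(\<lambda>y. indicat_real U y * H y) \<in> borel_measurable borel"
          using borel_measurable_continuous_on_indicator[of U H] continuous_on_subset[OF H(3) U(2)] by simp
        have weight: "(\<lambda>z. indicat_real ({0<..} \<times> U) z * H (snd z)) =
            (\<lambda>z. indicat_real {0<..} (fst z) * (indicat_real U (snd z) * H (snd z)))"
          by (rule ext) (simp add: indicator_def mem_Times_iff)
        have "(\<lambda>z. indicat_real ({0<..} \<times> U) z * H (snd z)) \<in> borel_measurable ?M"
          unfolding weight by measurable
        then show "(\<lambda>z. (indicat_real ({0<..} \<times> U) z * H (snd z)) * space_time_kernel U (r U) x z)
            \<in> borel_measurable ?M"
          by (rule borel_measurable_times[OF _ measurable_space_time_kernel[OF openU that contU]])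
      qed
      then have int': "integrable ?M (\<lambda>z. indicat_real ({0<..} \<times> U) z * dual_density H (r U) (fst z) x (snd z))"
        unfolding kern by simp
      have "resolvent (law Yhat) (killed U (path Yhat)) \<alpha> f x =
          (\<integral>z. indicat_real ({0<..} \<times> U) z * (exp (- \<alpha> * fst z) * f (snd z)) *
            (indicat_real ({0<..} \<times> U) z * dual_density H (r U) (fst z) x (snd z)) \<partial>?M)"
        by (rule resolvent_killed_eq_space_time_integral
            [OF Yhat' openV openU U(2) that rhat[OF U] int' f(1) C \<alpha>])
      also have "\<dots> = (\<integral>z. g z * space_time_kernel U (r U) x z / H x \<partial>?M)"
      proof (rule Bochner_Integration.integral_cong[OF refl])
        fix z
        show "indicat_real ({0<..} \<times> U) z * (exp (- \<alpha> * fst z) * f (snd z)) *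
            (indicat_real ({0<..} \<times> U) z * dual_density H (r U) (fst z) x (snd z)) =
            g z * space_time_kernel U (r U) x z / H x"
          unfolding kern by (cases "z \<in> {0<..} \<times> U") (simp_all add: g_def)
      qed
      finally show ?thesis by (simp add: I_def)
    qed
    have H0: "0 < H x" if "x \<in> U" for x using H(1) U that by auto
    show "continuous_on U (resolvent (law Yhat) (killed U (path Yhat)) \<alpha> f) \<and>
        bounded (resolvent (law Yhat) (killed U (path Yhat)) \<alpha> f ` U)"
    proof
      have "continuous_on U (\<lambda>x. I x / H x)"
        using H0 by (intro continuous_on_divide contI continuous_on_subset[OF H(3) U(2)]) (metis less_irrefl)
      then show "continuous_on U (resolvent (law Yhat) (killed U (path Yhat)) \<alpha> f)"
        by (rule continuous_on_eq) (simp add: res)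
      have "\<bar>I x / H x\<bar> \<le> C * B" if "x \<in> U" for x
        using I_le[OF that] H0[OF that] by (simp add: abs_divide pos_divide_le_eq)
      then show "bounded (resolvent (law Yhat) (killed U (path Yhat)) \<alpha> f ` U)"
        unfolding bounded_real by (auto simp: res)
    qed
  qed
qed

end
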